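(* Let $R$ be a ring, $*\in\{l,r,\emptyset\}$, and $S_1,\dots,S_n\in\mathbb{L}_*(R)$. Let $\mathfrak{p}_i=\mathrm{ass}_R(S_i)$, $R_i=R/\mathfrak{p}_i$, and $Q_i=R\langle S_i^{-1}\rangle$ the localization of $R$ at $S_i$. Suppose the rings $Q_i$ are simple Artinian, $\bigcap_{i=1}^n\mathfrak{p}_i=0$, and $\bigcap_{j\neq i}\mathfrak{p}_j\neq0$ for each $i=1,\dots,n$. Then \begin{enumerate} \item the rings $R_i$ are semiprime $*$ Goldie rings; \item $\min(R)=\{\mathfrak{p}_1,\dots,\mathfrak{p}_n\}$; \item $Q_i\simeq Q_{*,cl}(R_i)$ for $i=1,\dots,n$ (an $R$-isomorphism); \item $S_i\subseteq\mathcal{C}(\mathfrak{p}_i)$ for $i=1,\dots,n$; \item $Q_{*,cl}(R)\simeq\prod_{i=1}^nQ_i$; \item $\mathcal{C}(\mathfrak{p}_i)\in\max\mathbb{L}_*(R)$ for all $i=1,\dots,n$. \end{enumerate}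
   Context: Rings are associative with $1$. Multiplicative set: $SS\subseteq S$, $1\in S$, $0\notin S$. $R\langle S^{-1}\rangle=R\langle X_S\rangle/I_S$ ($R\langle X_S\rangle$ freely generated by $R$ and noncommuting $x_s$; $I_S$ generated by $sx_s-1,x_ss-1$); $\mathrm{ass}_R(S)=\ker(R\to R\langle S^{-1}\rangle)$. Left (resp. right) localizable: $R\langle S^{-1}\rangle\ne0$ and each element has the form $(x_s+I_S)(r+I_S)$ (resp. $(r+I_S)(x_s+I_S)$); localizable: both; $\mathbb{L}_l,\mathbb{L}_r,\mathbb{L}_\emptyset$ are these sets, $\max$ denotes maximal elements w.r.t. inclusion. "$*$ Goldie" means left Goldie, right Goldie, or (two-sided) Goldie for $*=l,r,\emptyset$. $Q_{l,cl}(A)=\mathcal{C}_A^{-1}A$, $Q_{r,cl}(A)=A\mathcal{C}_A^{-1}$, $Q_{\emptyset,cl}(A)$ the classical two-sided quotient ring, where $\mathcal{C}_A$ is the set of regular elements. $\min(R)$ is the set of minimal primes; $\mathcal{C}(\mathfrak{p})=\{c\in R:c+\mathfrak{p}\in\mathcal{C}_{R/\mathfrak{p}}\}$. *)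

theory Defs
  imports "HOL-Algebra.Algebra"
begin

datatype side = Left | Right | Both

definition mult_set :: "'a ring \<Rightarrow> 'a set \<Rightarrow> bool" where
  "mult_set R S \<longleftrightarrow> S \<subseteq> carrier R \<and> \<one>\<^bsub>R\<^esub> \<in> S \<and> \<zero>\<^bsub>R\<^esub> \<notin> S
     \<and> (\<forall>s\<in>S. \<forall>t\<in>S. s \<otimes>\<^bsub>R\<^esub> t \<in> S)"

definition left_ideal :: "'b set \<Rightarrow> 'b ring \<Rightarrow> bool" where
  "left_ideal I A \<longleftrightarrow> additive_subgroup I A \<and> (\<forall>x\<in>carrier A. \<forall>a\<in>I. x \<otimes>\<^bsub>A\<^esub> a \<in> I)"

definition right_ideal :: "'b set \<Rightarrow> 'b ring \<Rightarrow> bool" where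
  "right_ideal I A \<longleftrightarrow> additive_subgroup I A \<and> (\<forall>x\<in>carrier A. \<forall>a\<in>I. a \<otimes>\<^bsub>A\<^esub> x \<in> I)"

definition regular :: "'b ring \<Rightarrow> 'b set" where
  "regular A = {c \<in> carrier A. \<forall>x\<in>carrier A.
      (c \<otimes>\<^bsub>A\<^esub> x = \<zero>\<^bsub>A\<^esub> \<longrightarrow> x = \<zero>\<^bsub>A\<^esub>) \<and> (x \<otimes>\<^bsub>A\<^esub> c = \<zero>\<^bsub>A\<^esub> \<longrightarrow> x = \<zero>\<^bsub>A\<^esub>)}"

definition nc_prime :: "'b ring \<Rightarrow> 'b set \<Rightarrow> bool" where
  "nc_prime A P \<longleftrightarrow> ideal P A \<and> P \<noteq> carrier A \<and>
     (\<forall>I J. ideal I A \<and> ideal J A \<and> (\<forall>a\<in>I. \<forall>b\<in>J. a \<otimes>\<^bsub>A\<^esub> b \<in> P) \<longrightarrow> I \<subseteq> P \<or> J \<subseteq> P)"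

definition min_primes :: "'b ring \<Rightarrow> 'b set set" where
  "min_primes A = {P. nc_prime A P \<and> \<not> (\<exists>P'. nc_prime A P' \<and> P' \<subset> P)}"

definition C_of :: "'a ring \<Rightarrow> 'a set \<Rightarrow> 'a set" where
  "C_of R p = {c \<in> carrier R. p +>\<^bsub>R\<^esub> c \<in> regular (R Quot p)}"

definition semiprime :: "'b ring \<Rightarrow> bool" where
  "semiprime A \<longleftrightarrow> ring A \<and>
     (\<forall>I. ideal I A \<and> (\<forall>a\<in>I. \<forall>b\<in>I. a \<otimes>\<^bsub>A\<^esub> b = \<zero>\<^bsub>A\<^esub>) \<longrightarrow> I = {\<zero>\<^bsub>A\<^esub>})"

definition simple_ring :: "'b ring \<Rightarrow> bool" where
  "simple_ring A \<longleftrightarrow> ring A \<and> carrier A \<noteq> {\<zero>\<^bsub>A\<^esub>} \<and>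
     (\<forall>I. ideal I A \<longrightarrow> I = {\<zero>\<^bsub>A\<^esub>} \<or> I = carrier A)"

definition left_artinian :: "'b ring \<Rightarrow> bool" where
  "left_artinian A \<longleftrightarrow> ring A \<and>
     \<not> (\<exists>L :: nat \<Rightarrow> 'b set. \<forall>k. left_ideal (L k) A \<and> L (Suc k) \<subset> L k)"

definition simple_artinian :: "'b ring \<Rightarrow> bool" where
  "simple_artinian A \<longleftrightarrow> simple_ring A \<and> left_artinian A"

definition l_ann :: "'b ring \<Rightarrow> 'b set \<Rightarrow> 'b set" where
  "l_ann A Xs = {a \<in> carrier A. \<forall>y\<in>Xs. a \<otimes>\<^bsub>A\<^esub> y = \<zero>\<^bsub>A\<^esub>}"

definition r_ann :: "'b ring \<Rightarrow> 'b set \<Rightarrow> 'b set" where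
  "r_ann A Xs = {a \<in> carrier A. \<forall>y\<in>Xs. y \<otimes>\<^bsub>A\<^esub> a = \<zero>\<^bsub>A\<^esub>}"

definition independent_seq :: "'b ring \<Rightarrow> (nat \<Rightarrow> 'b set) \<Rightarrow> bool" where
  "independent_seq A L \<longleftrightarrow> (\<forall>m (a :: nat \<Rightarrow> 'b). (\<forall>k<m. a k \<in> L k) \<and>
       finsum A a {..<m} = \<zero>\<^bsub>A\<^esub> \<longrightarrow> (\<forall>k<m. a k = \<zero>\<^bsub>A\<^esub>))"

definition left_goldie :: "'b ring \<Rightarrow> bool" where
  "left_goldie A \<longleftrightarrow> ring A \<and>
     \<not> (\<exists>L :: nat \<Rightarrow> 'b set. \<forall>k. (\<exists>Xs \<subseteq> carrier A. L k = l_ann A Xs) \<and> L k \<subset> L (Suc k)) \<and>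
     \<not> (\<exists>L :: nat \<Rightarrow> 'b set. (\<forall>k. left_ideal (L k) A \<and> L k \<noteq> {\<zero>\<^bsub>A\<^esub>}) \<and> independent_seq A L)"

definition right_goldie :: "'b ring \<Rightarrow> bool" where
  "right_goldie A \<longleftrightarrow> ring A \<and>
     \<not> (\<exists>L :: nat \<Rightarrow> 'b set. \<forall>k. (\<exists>Xs \<subseteq> carrier A. L k = r_ann A Xs) \<and> L k \<subset> L (Suc k)) \<and>
     \<not> (\<exists>L :: nat \<Rightarrow> 'b set. (\<forall>k. right_ideal (L k) A \<and> L k \<noteq> {\<zero>\<^bsub>A\<^esub>}) \<and> independent_seq A L)"

definition goldie :: "side \<Rightarrow> 'b ring \<Rightarrow> bool" where
  "goldie sd A = (case sd of Left \<Rightarrow> left_goldie A | Right \<Rightarrow> right_goldie A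
                   | Both \<Rightarrow> left_goldie A \<and> right_goldie A)"

definition is_lcq :: "'b ring \<Rightarrow> 'c ring \<Rightarrow> ('b \<Rightarrow> 'c) \<Rightarrow> bool" where
  "is_lcq A Q \<sigma> \<longleftrightarrow> ring Q \<and> \<sigma> \<in> ring_hom A Q \<and> inj_on \<sigma> (carrier A) \<and>
     \<sigma> ` regular A \<subseteq> Units Q \<and>
     (\<forall>q\<in>carrier Q. \<exists>c\<in>regular A. \<exists>a\<in>carrier A. q = inv\<^bsub>Q\<^esub> (\<sigma> c) \<otimes>\<^bsub>Q\<^esub> \<sigma> a)"

definition is_rcq :: "'b ring \<Rightarrow> 'c ring \<Rightarrow> ('b \<Rightarrow> 'c) \<Rightarrow> bool" where
  "is_rcq A Q \<sigma> \<longleftrightarrow> ring Q \<and> \<sigma> \<in> ring_hom A Q \<and> inj_on \<sigma> (carrier A) \<and>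
     \<sigma> ` regular A \<subseteq> Units Q \<and>
     (\<forall>q\<in>carrier Q. \<exists>c\<in>regular A. \<exists>a\<in>carrier A. q = \<sigma> a \<otimes>\<^bsub>Q\<^esub> inv\<^bsub>Q\<^esub> (\<sigma> c))"

definition is_clq :: "side \<Rightarrow> 'b ring \<Rightarrow> 'c ring \<Rightarrow> ('b \<Rightarrow> 'c) \<Rightarrow> bool" where
  "is_clq sd A Q \<sigma> = (case sd of Left \<Rightarrow> is_lcq A Q \<sigma> | Right \<Rightarrow> is_rcq A Q \<sigma>
                   | Both \<Rightarrow> is_lcq A Q \<sigma> \<and> is_rcq A Q \<sigma>)"

text \<open>Free (noncommutative) ring \<open>\<int>\<langle>V\<rangle>\<close> on a set of variables \<open>V\<close>:
  finitely supported integer-valued functions on words over \<open>V\<close>,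
  with multiplication given by concatenation of words.\<close>
definition free_ring :: "'v set \<Rightarrow> ('v list \<Rightarrow> int) ring" where
  "free_ring V = \<lparr> partial_object.carrier = {f. finite {w. f w \<noteq> 0} \<and> (\<forall>w. f w \<noteq> 0 \<longrightarrow> set w \<subseteq> V)},
      monoid.mult = (\<lambda>f g w. \<Sum>i\<le>length w. f (take i w) * g (drop i w)),
      monoid.one = (\<lambda>w. if w = [] then 1 else 0),
      ring.zero = (\<lambda>w. 0),
      ring.add = (\<lambda>f g w. f w + g w) \<rparr>"

definition fgen :: "'v \<Rightarrow> ('v list \<Rightarrow> int)" where
  "fgen v = (\<lambda>w. if w = [v] then 1 else 0)"

definition fsub :: "('v list \<Rightarrow> int) \<Rightarrow> ('v list \<Rightarrow> int) \<Rightarrow> ('v list \<Rightarrow> int)" where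
  "fsub f g = (\<lambda>w. f w - g w)"

text \<open>Variables: \<open>Inl r\<close> stands for the generator corresponding to \<open>r \<in> R\<close>,
  \<open>Inr s\<close> for the noncommuting variable \<open>x_s\<close>, \<open>s \<in> S\<close>.\<close>
definition loc_vars :: "'a ring \<Rightarrow> 'a set \<Rightarrow> ('a + 'a) set" where
  "loc_vars R S = Inl ` carrier R \<union> Inr ` S"

text \<open>Relations: the first three families present \<open>R\<langle>X_S\<rangle>\<close> (the ring freely
  generated by \<open>R\<close> and the \<open>x_s\<close>); the last two generate \<open>I_S\<close>.\<close>
definition loc_rels :: "'a ring \<Rightarrow> 'a set \<Rightarrow> (('a + 'a) list \<Rightarrow> int) set" where
  "loc_rels R S =
     {fsub (fgen (Inl (r \<oplus>\<^bsub>R\<^esub> r'))) (\<lambda>w. fgen (Inl r) w + fgen (Inl r') w) | r r'.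
        r \<in> carrier R \<and> r' \<in> carrier R}
   \<union> {fsub (fgen (Inl (r \<otimes>\<^bsub>R\<^esub> r'))) (fgen (Inl r) \<otimes>\<^bsub>free_ring (loc_vars R S)\<^esub> fgen (Inl r')) | r r'.
        r \<in> carrier R \<and> r' \<in> carrier R}
   \<union> {fsub (fgen (Inl \<one>\<^bsub>R\<^esub>)) \<one>\<^bsub>free_ring (loc_vars R S)\<^esub>}
   \<union> {fsub (fgen (Inl s) \<otimes>\<^bsub>free_ring (loc_vars R S)\<^esub> fgen (Inr s)) \<one>\<^bsub>free_ring (loc_vars R S)\<^esub> | s. s \<in> S}
   \<union> {fsub (fgen (Inr s) \<otimes>\<^bsub>free_ring (loc_vars R S)\<^esub> fgen (Inl s)) \<one>\<^bsub>free_ring (loc_vars R S)\<^esub> | s. s \<in> S}"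

definition loc_ideal :: "'a ring \<Rightarrow> 'a set \<Rightarrow> (('a + 'a) list \<Rightarrow> int) set" where
  "loc_ideal R S = genideal (free_ring (loc_vars R S)) (loc_rels R S)"

definition loc_ring :: "'a ring \<Rightarrow> 'a set \<Rightarrow> (('a + 'a) list \<Rightarrow> int) set ring" where
  "loc_ring R S = free_ring (loc_vars R S) Quot loc_ideal R S"

definition loc_map :: "'a ring \<Rightarrow> 'a set \<Rightarrow> 'a \<Rightarrow> (('a + 'a) list \<Rightarrow> int) set" where
  "loc_map R S r = loc_ideal R S +>\<^bsub>free_ring (loc_vars R S)\<^esub> fgen (Inl r)"

definition loc_x :: "'a ring \<Rightarrow> 'a set \<Rightarrow> 'a \<Rightarrow> (('a + 'a) list \<Rightarrow> int) set" where
  "loc_x R S s = loc_ideal R S +>\<^bsub>free_ring (loc_vars R S)\<^esub> fgen (Inr s)"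

definition ass :: "'a ring \<Rightarrow> 'a set \<Rightarrow> 'a set" where
  "ass R S = {r \<in> carrier R. loc_map R S r = \<zero>\<^bsub>loc_ring R S\<^esub>}"

definition left_localizable :: "'a ring \<Rightarrow> 'a set \<Rightarrow> bool" where
  "left_localizable R S \<longleftrightarrow> carrier (loc_ring R S) \<noteq> {\<zero>\<^bsub>loc_ring R S\<^esub>} \<and>
     (\<forall>q\<in>carrier (loc_ring R S). \<exists>s\<in>S. \<exists>r\<in>carrier R.
        q = loc_x R S s \<otimes>\<^bsub>loc_ring R S\<^esub> loc_map R S r)"

definition right_localizable :: "'a ring \<Rightarrow> 'a set \<Rightarrow> bool" where
  "right_localizable R S \<longleftrightarrow> carrier (loc_ring R S) \<noteq> {\<zero>\<^bsub>loc_ring R S\<^esub>} \<and>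
     (\<forall>q\<in>carrier (loc_ring R S). \<exists>s\<in>S. \<exists>r\<in>carrier R.
        q = loc_map R S r \<otimes>\<^bsub>loc_ring R S\<^esub> loc_x R S s)"

definition localizable :: "side \<Rightarrow> 'a ring \<Rightarrow> 'a set \<Rightarrow> bool" where
  "localizable sd R S \<longleftrightarrow> mult_set R S \<and>
     (case sd of Left \<Rightarrow> left_localizable R S | Right \<Rightarrow> right_localizable R S
      | Both \<Rightarrow> left_localizable R S \<and> right_localizable R S)"

definition max_localizable :: "side \<Rightarrow> 'a ring \<Rightarrow> 'a set \<Rightarrow> bool" where
  "max_localizable sd R S \<longleftrightarrow> localizable sd R S \<and>
     \<not> (\<exists>T. localizable sd R T \<and> S \<subset> T)"

definition prod_ring :: "nat \<Rightarrow> (nat \<Rightarrow> 'c ring) \<Rightarrow> (nat \<Rightarrow> 'c) ring" where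
  "prod_ring n Q = \<lparr> partial_object.carrier = PiE {..<n} (\<lambda>i. carrier (Q i)),
      monoid.mult = (\<lambda>f g. \<lambda>i\<in>{..<n}. f i \<otimes>\<^bsub>Q i\<^esub> g i),
      monoid.one = (\<lambda>i\<in>{..<n}. \<one>\<^bsub>Q i\<^esub>),
      ring.zero = (\<lambda>i\<in>{..<n}. \<zero>\<^bsub>Q i\<^esub>),
      ring.add = (\<lambda>f g. \<lambda>i\<in>{..<n}. f i \<oplus>\<^bsub>Q i\<^esub> g i) \<rparr>"

end

theory Submission
  imports Defs
begin

text \<open>If \<open>Q\<close> is a simple left Artinian ring of left fractions of \<open>R\<close> with denominators
  in \<open>S\<close>, then the left ideal \<open>QJ\<close> generated by an ideal \<open>J\<close> of \<open>R\<close> is two-sided, since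
  the descending chain \<open>QJ \<supseteq> QJs \<supseteq> QJs\<^sup>2 \<supseteq> \<dots>\<close> stabilizes for every \<open>s \<in> S\<close>. So \<open>QJ\<close>
  is \<open>0\<close> or \<open>Q\<close>, and every ideal of \<open>R\<close> not contained in the kernel \<open>p\<close> of \<open>R \<rightarrow> Q\<close>
  meets \<open>S\<close> modulo \<open>p\<close>. This makes \<open>p\<close> prime and, in the situation of the theorem, produces
  elements of \<open>R\<close> that are invertible in one \<open>Q\<^sub>i\<close> and vanish in the others; they separate
  the factors of the product of the \<open>Q\<^sub>i\<close>. In a left Artinian ring an element with zero left
  annihilator is a unit, so regular elements of \<open>R/p\<close> are invertible in \<open>Q\<close>. The right-hand
  versions follow by passing to opposite rings, because a simple left Artinian ring is also
  right Artinian.\<close>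

section \<open>Opposite rings\<close>

text \<open>\<open>simple_artinian\<close> asks for the left chain condition whatever the side, so
  the symmetry of the Artinian property matters even for the left half of the theorem: an ascending
  chain of left annihilators in R/p turns into a descending chain of right ideals of Q. Both Goldie
  conditions are read off from the embedding of R/p in Q.

  The obstacle in handling denominators is that elements of S may be zero divisors, so identities
  between fractions hold in Q only. All arguments therefore run on images under the map h from R to
  Q, that is, modulo p; common denominators come from rewriting the product of h(s1) and the inverse
  of h(s2) as a left fraction.

  Maximality of C(p) compares localizations that are given by generators and relations, hence
  through their universal property: if T contains C(p) and is localizable, the simple ring Q maps
  injectively to the nonzero localization at T, so elements of T are regular modulo p.\<close>

definition op_ring :: "'a ring \<Rightarrow> 'a ring" where
  "op_ring A = \<lparr> partial_object.carrier = carrier A,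
      monoid.mult = (\<lambda>x y. y \<otimes>\<^bsub>A\<^esub> x),
      monoid.one = \<one>\<^bsub>A\<^esub>,
      ring.zero = \<zero>\<^bsub>A\<^esub>,
      ring.add = add A \<rparr>"

lemma op_ring_simps [simp]:
  "carrier (op_ring A) = carrier A" "x \<otimes>\<^bsub>op_ring A\<^esub> y = y \<otimes>\<^bsub>A\<^esub> x"
  "\<one>\<^bsub>op_ring A\<^esub> = \<one>\<^bsub>A\<^esub>" "\<zero>\<^bsub>op_ring A\<^esub> = \<zero>\<^bsub>A\<^esub>" "add (op_ring A) = add A"
  by (simp_all add: op_ring_def)

lemma op_ring_op_ring [simp]: "op_ring (op_ring A) = A"
  by (simp add: op_ring_def)

lemma add_monoid_op_ring [simp]: "add_monoid (op_ring A) = add_monoid A"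
  by (simp add: op_ring_def)

lemma ring_op_ring: "ring A \<Longrightarrow> ring (op_ring A)"
proof -
  assume "ring A"
  then interpret ring A .
  show ?thesis
  proof (rule ringI)
    show "abelian_group (op_ring A)"
      by (metis abelian_group_axioms abelian_group_def abelian_group_axioms_def abelian_monoid_def
          add_monoid_op_ring)
    show "Group.monoid (op_ring A)"
      by (rule monoidI) (auto simp: m_assoc)
  qed (auto simp: l_distr r_distr)
qed

lemma ring_op_ring_iff [simp]: "ring (op_ring A) \<longleftrightarrow> ring A"
  by (metis ring_op_ring op_ring_op_ring)

lemma additive_subgroup_op_ring [simp]: "additive_subgroup I (op_ring A) = additive_subgroup I A"
  by (simp add: additive_subgroup_def)

lemma ideal_op_ring [simp]: "ideal I (op_ring A) = ideal I A"
  unfolding ideal_def ideal_axioms_def by auto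

lemma left_ideal_op_ring [simp]: "left_ideal I (op_ring A) = right_ideal I A"
  and right_ideal_op_ring [simp]: "right_ideal I (op_ring A) = left_ideal I A"
  by (simp_all add: left_ideal_def right_ideal_def)

lemma Units_op_ring [simp]: "Units (op_ring A) = Units A"
  by (auto simp: Units_def)

lemma inv_op_ring [simp]: "inv\<^bsub>op_ring A\<^esub> x = inv\<^bsub>A\<^esub> x"
  by (simp add: m_inv_def conj_commute)

lemma ring_hom_op_ring [simp]: "ring_hom (op_ring A) (op_ring B) = ring_hom A B"
  by (auto simp: ring_hom_def)

lemma regular_op_ring [simp]: "regular (op_ring A) = regular A"
  by (auto simp: regular_def)

lemma nc_prime_op_ring [simp]: "nc_prime (op_ring A) P = nc_prime A P"
  unfolding nc_prime_def by auto

lemma min_primes_op_ring [simp]: "min_primes (op_ring A) = min_primes A"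
  by (simp add: min_primes_def)

lemma semiprime_op_ring [simp]: "semiprime (op_ring A) = semiprime A"
  unfolding semiprime_def by auto

lemma simple_ring_op_ring [simp]: "simple_ring (op_ring A) = simple_ring A"
  by (simp add: simple_ring_def)

lemma a_r_coset_op_ring [simp]: "I +>\<^bsub>op_ring A\<^esub> x = I +>\<^bsub>A\<^esub> x"
  by (simp add: a_r_coset_def)

text \<open>Cosets and their sums depend on addition alone; the coset product merely swaps its
  arguments. Hence an equality of rings rather than an isomorphism, and right-hand facts follow by
  rewriting.\<close>

lemma FactRing_op_ring [simp]: "op_ring A Quot I = op_ring (A Quot I)"
proof -
  have "a_rcosets\<^bsub>op_ring A\<^esub> I = a_rcosets\<^bsub>A\<^esub> I"
    by (simp add: A_RCOSETS_def)
  moreover have "rcoset_mult (op_ring A) I = (\<lambda>U V. rcoset_mult A I V U)"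
    by (auto simp: rcoset_mult_def fun_eq_iff)
  moreover have "set_add (op_ring A) = set_add A"
    by (simp add: set_add_def fun_eq_iff)
  ultimately show ?thesis
    by (subst op_ring_def[of "A Quot I"]) (simp add: FactRing_def)
qed

lemma C_of_op_ring [simp]: "C_of (op_ring A) p = C_of A p"
  by (simp add: C_of_def)

lemma a_kernel_op_ring [simp]: "a_kernel (op_ring A) (op_ring B) h = a_kernel A B h"
  by (simp add: a_kernel_def kernel_def)

lemma prod_ring_op_ring [simp]: "prod_ring n (\<lambda>i. op_ring (Q i)) = op_ring (prod_ring n Q)"
  by (simp add: prod_ring_def op_ring_def)

lemma l_ann_op_ring [simp]: "l_ann (op_ring A) Y = r_ann A Y"
  and r_ann_op_ring [simp]: "r_ann (op_ring A) Y = l_ann A Y"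
  by (simp_all add: l_ann_def r_ann_def)

lemma left_goldie_op_ring [simp]: "left_goldie (op_ring A) = right_goldie A"
proof -
  have "finsum (op_ring A) a K = finsum A a K" for a and K :: "nat set"
    by (simp add: finsum_def)
  then have "independent_seq (op_ring A) L = independent_seq A L" for L
    by (simp add: independent_seq_def)
  then show ?thesis
    by (simp add: left_goldie_def right_goldie_def)
qed

lemma is_lcq_op_ring [simp]: "is_lcq (op_ring A) (op_ring B) h = is_rcq A B h"
  by (simp add: is_lcq_def is_rcq_def)

section \<open>Simple left Artinian rings\<close>

locale nc_ring = ring R for R :: "'a ring" (structure)

lemma nc_ring_iff: "nc_ring R \<longleftrightarrow> ring R"
  by (simp add: nc_ring_def)

section \<open>One-sided ideals and the descending chain condition\<close>

context nc_ring
begin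

lemma nc_ring_op_ring: "nc_ring (op_ring R)"
  by (simp add: nc_ring_iff ring_axioms)

lemma additive_subgroupI:
  assumes "I \<subseteq> carrier R" "\<zero> \<in> I" "\<And>a b. a \<in> I \<Longrightarrow> b \<in> I \<Longrightarrow> a \<oplus> b \<in> I"
    "\<And>a. a \<in> I \<Longrightarrow> \<ominus> a \<in> I"
  shows "additive_subgroup I R"
  unfolding additive_subgroup_def
  by (rule add.subgroupI) (use assms in \<open>auto simp: a_inv_def\<close>)

lemma left_idealI:
  assumes "I \<subseteq> carrier R" "\<zero> \<in> I" "\<And>a b. a \<in> I \<Longrightarrow> b \<in> I \<Longrightarrow> a \<oplus> b \<in> I"
    "\<And>x a. x \<in> carrier R \<Longrightarrow> a \<in> I \<Longrightarrow> x \<otimes> a \<in> I"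
  shows "left_ideal I R"
proof -
  \<comment> \<open>Negation is left multiplication by \<open>\<ominus> \<one>\<close>.\<close>
  have "\<ominus> a \<in> I" if "a \<in> I" for a
    using assms(4)[of "\<ominus> \<one>" a] that assms(1) by (auto simp: l_minus)
  then show ?thesis
    unfolding left_ideal_def by (intro conjI additive_subgroupI) (use assms in auto)
qed

lemma left_idealD:
  assumes "left_ideal I R"
  shows "I \<subseteq> carrier R" "\<zero> \<in> I" "\<And>a b. a \<in> I \<Longrightarrow> b \<in> I \<Longrightarrow> a \<oplus> b \<in> I"
    "\<And>x a. x \<in> carrier R \<Longrightarrow> a \<in> I \<Longrightarrow> x \<otimes> a \<in> I"
    "\<And>a. a \<in> I \<Longrightarrow> \<ominus> a \<in> I"
    "\<And>a b. a \<in> I \<Longrightarrow> b \<in> I \<Longrightarrow> a \<ominus> b \<in> I"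
proof -
  interpret additive_subgroup I R
    using assms by (simp add: left_ideal_def)
  show "I \<subseteq> carrier R" "\<zero> \<in> I" "\<And>a b. a \<in> I \<Longrightarrow> b \<in> I \<Longrightarrow> a \<oplus> b \<in> I"
    "\<And>x a. x \<in> carrier R \<Longrightarrow> a \<in> I \<Longrightarrow> x \<otimes> a \<in> I"
    using assms a_subset by (auto simp: left_ideal_def)
  show minus: "\<ominus> a \<in> I" if "a \<in> I" for a
    using that a_inv_closed by blast
  show "a \<ominus> b \<in> I" if "a \<in> I" "b \<in> I" for a b
    using that minus by (simp add: a_minus_def)
qed

lemma right_idealI:
  assumes "I \<subseteq> carrier R" "\<zero> \<in> I" "\<And>a b. a \<in> I \<Longrightarrow> b \<in> I \<Longrightarrow> a \<oplus> b \<in> I"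
    "\<And>x a. x \<in> carrier R \<Longrightarrow> a \<in> I \<Longrightarrow> a \<otimes> x \<in> I"
  shows "right_ideal I R"
  using nc_ring.left_idealI[OF nc_ring_op_ring, of I] assms by simp

lemma right_idealD:
  assumes "right_ideal I R"
  shows "I \<subseteq> carrier R" "\<zero> \<in> I" "\<And>x a. x \<in> carrier R \<Longrightarrow> a \<in> I \<Longrightarrow> a \<otimes> x \<in> I"
  using nc_ring.left_idealD[OF nc_ring_op_ring, of I] assms by simp_all

lemma ideal_iff_left_right: "ideal I R \<longleftrightarrow> left_ideal I R \<and> right_ideal I R"
  using ring_axioms by (auto simp: ideal_def ideal_axioms_def left_ideal_def right_ideal_def)

lemma add_minus_eq_zeroD: "x \<in> carrier R \<Longrightarrow> y \<in> carrier R \<Longrightarrow> x \<ominus> y = \<zero> \<Longrightarrow> x = y"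
  by (simp add: a_minus_def) (metis add.inv_closed add.inv_equality minus_minus)

lemma left_ideal_carrier: "left_ideal (carrier R) R"
  by (rule left_idealI) auto

lemma left_ideal_times:
  assumes "left_ideal I R" "x \<in> carrier R"
  shows "left_ideal {a \<otimes> x | a. a \<in> I} R"
proof (rule left_idealI)
  note I = left_idealD[OF assms(1)]
  show "{a \<otimes> x | a. a \<in> I} \<subseteq> carrier R" using I(1) assms(2) by auto
  show "\<zero> \<in> {a \<otimes> x | a. a \<in> I}" using I(2) assms(2) by (force simp: l_null)
  fix a b
  assume "a \<in> {a \<otimes> x | a. a \<in> I}" "b \<in> {a \<otimes> x | a. a \<in> I}"
  then obtain a' b' where "a = a' \<otimes> x" "b = b' \<otimes> x" "a' \<in> I" "b' \<in> I" by auto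
  then show "a \<oplus> b \<in> {a \<otimes> x | a. a \<in> I}"
    using I(1,3) assms(2) by (auto simp: l_distr subset_iff intro!: exI[of _ "a' \<oplus> b'"])
next
  note I = left_idealD[OF assms(1)]
  fix y a assume "y \<in> carrier R" "a \<in> {a \<otimes> x | a. a \<in> I}"
  then obtain a' where "a = a' \<otimes> x" "a' \<in> I" by auto
  then show "y \<otimes> a \<in> {a \<otimes> x | a. a \<in> I}"
    using I(1,4) assms(2) \<open>y \<in> carrier R\<close>
    by (auto simp: m_assoc subset_iff intro!: exI[of _ "y \<otimes> a'"])
qed

lemma left_ideal_principal:
  "x \<in> carrier R \<Longrightarrow> left_ideal {r \<otimes> x | r. r \<in> carrier R} R"
  using left_ideal_times[OF left_ideal_carrier] .

lemma left_ideal_add: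
  assumes "left_ideal I R" "left_ideal J R"
  shows "left_ideal {a \<oplus> b | a b. a \<in> I \<and> b \<in> J} R"
proof (rule left_idealI)
  note I = left_idealD[OF assms(1)] and J = left_idealD[OF assms(2)]
  show "{a \<oplus> b | a b. a \<in> I \<and> b \<in> J} \<subseteq> carrier R" using I(1) J(1) by auto
  show "\<zero> \<in> {a \<oplus> b | a b. a \<in> I \<and> b \<in> J}" using I(2) J(2) l_zero zero_closed by force
  fix x y
  assume "x \<in> {a \<oplus> b | a b. a \<in> I \<and> b \<in> J}" "y \<in> {a \<oplus> b | a b. a \<in> I \<and> b \<in> J}"
  then obtain a b a' b' where *: "x = a \<oplus> b" "y = a' \<oplus> b'" "a \<in> I" "b \<in> J" "a' \<in> I" "b' \<in> J"
    by auto
  then have "x \<oplus> y = (a \<oplus> a') \<oplus> (b \<oplus> b')"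
    using I(1) J(1) by (simp add: subset_iff a_ac)
  then show "x \<oplus> y \<in> {a \<oplus> b | a b. a \<in> I \<and> b \<in> J}" using * I(3) J(3) by blast
next
  note I = left_idealD[OF assms(1)] and J = left_idealD[OF assms(2)]
  fix r x assume "r \<in> carrier R" "x \<in> {a \<oplus> b | a b. a \<in> I \<and> b \<in> J}"
  then obtain a b where *: "x = a \<oplus> b" "a \<in> I" "b \<in> J" by auto
  then have "r \<otimes> x = r \<otimes> a \<oplus> r \<otimes> b"
    using I(1) J(1) \<open>r \<in> carrier R\<close> by (simp add: subset_iff r_distr)
  then show "r \<otimes> x \<in> {a \<oplus> b | a b. a \<in> I \<and> b \<in> J}" using * I(4) J(4) \<open>r \<in> carrier R\<close> by blast
qed

text \<open>A single equality of neighbours is what the absence of strictly descending chains gives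
  at once, and it suffices for the arguments with powers of an element.\<close>

lemma left_artinian_stable:
  assumes "left_artinian R" "\<And>k. left_ideal (L k) R" "\<And>k. L (Suc k) \<subseteq> L k"
  obtains k :: nat where "L (Suc k) = L k"
  using assms unfolding left_artinian_def by (metis psubsetI)

text \<open>The chain condition is well-foundedness of strict inclusion once the relation is
  restricted to left ideals.\<close>

lemma left_artinian_minimal:
  assumes "left_artinian R" "left_ideal I R" "P I"
  obtains J where "left_ideal J R" "P J" "\<And>K. left_ideal K R \<Longrightarrow> P K \<Longrightarrow> \<not> K \<subset> J"
proof -
  have "wf {(K, J). left_ideal K R \<and> left_ideal J R \<and> K \<subset> J}" (is "wf ?r")
    unfolding wf_iff_no_infinite_down_chain
  proof
    assume "\<exists>f. \<forall>i. (f (Suc i), f i) \<in> ?r"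
    then obtain f where "\<forall>i. (f (Suc i), f i) \<in> ?r" by blast
    then have "\<forall>i. left_ideal (f i) R \<and> f (Suc i) \<subset> f i" by blast
    then show False using assms(1) unfolding left_artinian_def by blast
  qed
  then obtain J where "J \<in> {J. left_ideal J R \<and> P J}"
    and "\<And>K. (K, J) \<in> ?r \<Longrightarrow> K \<notin> {J. left_ideal J R \<and> P J}"
    by (rule wfE_min[of ?r I "{J. left_ideal J R \<and> P J}"]) (use assms in auto)
  then show thesis using that[of J] by auto
qed

text \<open>The chain of left ideals generated by the powers of c stabilizes, so c^k = q c^(k+1) for
  some q. Cancelling c^k on the right gives q c = 1, and then (c q - 1) c = 0 gives c q = 1.\<close>

lemma left_artinian_Units:
  assumes "left_artinian R" "c \<in> carrier R"
    and inj: "\<And>x. x \<in> carrier R \<Longrightarrow> x \<otimes> c = \<zero> \<Longrightarrow> x = \<zero>"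
  shows "c \<in> Units R"
proof -
  have inj_pow: "x = \<zero>" if "x \<in> carrier R" "x \<otimes> c [^] k = \<zero>" for x and k :: nat
    using that
  proof (induction k arbitrary: x)
    case (Suc k)
    have "(x \<otimes> c) \<otimes> c [^] k = \<zero>"
      using Suc.prems assms(2) nat_pow_Suc2[OF assms(2), of k] by (simp add: m_assoc del: nat_pow_Suc)
    then show ?case using Suc.IH[of "x \<otimes> c"] Suc.prems(1) assms(2) inj by blast
  qed simp
  define L where "L k = {r \<otimes> c [^] k | r. r \<in> carrier R}" for k :: nat
  have "L (Suc k) \<subseteq> L k" for k
  proof
    fix x assume "x \<in> L (Suc k)"
    then obtain r where "r \<in> carrier R" "x = r \<otimes> c [^] Suc k" unfolding L_def by blast
    then have "r \<otimes> c \<in> carrier R" "x = (r \<otimes> c) \<otimes> c [^] k"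
      using assms(2) nat_pow_Suc2[OF assms(2), of k] by (simp_all add: m_assoc del: nat_pow_Suc)
    then show "x \<in> L k" unfolding L_def by blast
  qed
  moreover have "left_ideal (L k) R" for k
    unfolding L_def using assms(2) by (intro left_ideal_principal) auto
  ultimately obtain k where "L (Suc k) = L k"
    using left_artinian_stable[OF assms(1)] by metis
  moreover have "c [^] k \<in> L k"
    unfolding L_def using assms(2) by (auto intro!: exI[of _ \<one>])
  ultimately obtain q where q: "q \<in> carrier R" "c [^] k = q \<otimes> c [^] Suc k"
    unfolding L_def by blast
  then have "(\<one> \<ominus> q \<otimes> c) \<otimes> c [^] k = \<zero>"
  proof -
    have "(q \<otimes> c) \<otimes> c [^] k = c [^] k"
      using q assms(2) nat_pow_Suc2[OF assms(2), of k] by (simp add: m_assoc del: nat_pow_Suc)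
    then show ?thesis
      using q(1) assms(2) by (simp add: a_minus_def l_distr l_minus r_neg)
  qed
  then have "\<one> \<ominus> q \<otimes> c = \<zero>" using q(1) assms(2) inj_pow by simp
  then have qc: "q \<otimes> c = \<one>"
    using q(1) assms(2) add_minus_eq_zeroD[of \<one> "q \<otimes> c"] by simp
  have "(c \<otimes> q \<ominus> \<one>) \<otimes> c = \<zero>"
    using q(1) assms(2) qc by (simp add: a_minus_def l_distr m_assoc l_minus r_neg)
  then have "c \<otimes> q \<ominus> \<one> = \<zero>" by (rule inj[rotated]) (use q(1) assms(2) in simp)
  then have "c \<otimes> q = \<one>"
    using q(1) assms(2) add_minus_eq_zeroD[of "c \<otimes> q" \<one>] by blast
  with qc show ?thesis using q(1) assms(2) unfolding Units_def by blast
qed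

end

text \<open>For a left ideal J this says that J is an Artinian left module. Chains of left ideals of
  the whole ring, cut down to J, are used in place of chains inside J because sums and preimages of
  left ideals then stay within the same kind of chain.\<close>

definition dcc_on :: "'a ring \<Rightarrow> 'a set \<Rightarrow> bool" where
  "dcc_on A J \<longleftrightarrow> (\<forall>I :: nat \<Rightarrow> 'a set. (\<forall>k. left_ideal (I k) A \<and> I (Suc k) \<subseteq> I k)
     \<longrightarrow> (\<exists>N. \<forall>k\<ge>N. I N \<inter> J \<subseteq> I k))"

definition minimal_left_ideal :: "'a ring \<Rightarrow> 'a set \<Rightarrow> bool" where
  "minimal_left_ideal A M \<longleftrightarrow> left_ideal M A \<and> M \<noteq> {\<zero>\<^bsub>A\<^esub>} \<and>
     (\<forall>I. left_ideal I A \<and> I \<subseteq> M \<longrightarrow> I = {\<zero>\<^bsub>A\<^esub>} \<or> I = M)"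

context nc_ring
begin

text \<open>Either M lies in every member of the chain, or some member meets M in zero, and so do
  all later ones.\<close>

lemma dcc_on_minimal:
  assumes "minimal_left_ideal R M"
  shows "dcc_on R M"
  unfolding dcc_on_def
proof (intro allI impI)
  fix I :: "nat \<Rightarrow> 'a set"
  assume I: "\<forall>k. left_ideal (I k) R \<and> I (Suc k) \<subseteq> I k"
  have M: "left_ideal M R" using assms by (simp add: minimal_left_ideal_def)
  show "\<exists>N. \<forall>k\<ge>N. I N \<inter> M \<subseteq> I k"
  proof (cases "\<forall>k. M \<subseteq> I k")
    case False
    then obtain N where "\<not> M \<subseteq> I N" by auto
    moreover have "left_ideal (I N \<inter> M) R"
      using left_idealD[OF M] left_idealD[of "I N"] I by (intro left_idealI) auto
    ultimately have "I N \<inter> M = {\<zero>}"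
      using assms unfolding minimal_left_ideal_def by blast
    then have "\<forall>k\<ge>N. I N \<inter> M \<subseteq> I k" using left_idealD(2) I by auto
    then show ?thesis by blast
  qed auto
qed

text \<open>The argument for module extensions: the chains I k cut with J and (I k + J) cut with K
  both stabilize. If x = j + n lies in I N, then n = x - j lies in I N + J, hence n = a + j' with a
  in I k; now x - a = j + j' lies in J and in an early member of the chain, so in I k, and x
  follows.\<close>

lemma dcc_on_add:
  assumes "left_ideal J R" "left_ideal K R" "dcc_on R J" "dcc_on R K"
  shows "dcc_on R {a \<oplus> b | a b. a \<in> J \<and> b \<in> K}"
  unfolding dcc_on_def
proof (intro allI impI)
  fix I :: "nat \<Rightarrow> 'a set"
  assume I: "\<forall>k. left_ideal (I k) R \<and> I (Suc k) \<subseteq> I k"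
  note Id = left_idealD[OF I[rule_format, THEN conjunct1]]
  note Jd = left_idealD[OF assms(1)] and Kd = left_idealD[OF assms(2)]
  define I' where "I' k = {a \<oplus> b | a b. a \<in> I k \<and> b \<in> J}" for k
  have "\<forall>k. left_ideal (I' k) R \<and> I' (Suc k) \<subseteq> I' k"
    unfolding I'_def using left_ideal_add I assms(1) by blast
  then obtain N1 where N1: "\<And>k. k \<ge> N1 \<Longrightarrow> I' N1 \<inter> K \<subseteq> I' k"
    using assms(4) unfolding dcc_on_def by blast
  obtain N2 where N2: "\<And>k. k \<ge> N2 \<Longrightarrow> I N2 \<inter> J \<subseteq> I k"
    using assms(3) I unfolding dcc_on_def by blast
  have anti: "I k \<subseteq> I j" if "j \<le> k" for j k
    using that I lift_Suc_antimono_le[of I] by blast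
  define N where "N = max N1 N2"
  have "x \<in> I k" if k: "k \<ge> N" and x: "x \<in> I N" "x = j \<oplus> n" "j \<in> J" "n \<in> K" for k x j n
  proof -
    have car: "x \<in> carrier R" "j \<in> carrier R" "n \<in> carrier R"
      using x Id(1) Jd(1) Kd(1) by blast+
    have "n = x \<oplus> \<ominus> j" using car x(2) by (simp add: a_comm[of j n] a_assoc r_neg)
    then have "n \<in> I' N1"
      unfolding I'_def using x anti[of N1 N] Jd(5) by (auto simp: N_def)
    then have "n \<in> I' k" using N1[of k] k x(4) by (auto simp: N_def)
    then obtain a j' where a: "n = a \<oplus> j'" "a \<in> I k" "j' \<in> J" unfolding I'_def by auto
    have car': "a \<in> carrier R" "j' \<in> carrier R" using a Id(1) Jd(1) by blast+
    have eq: "x \<ominus> a = j \<oplus> j'"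
    proof -
      have "x = (j \<oplus> j') \<oplus> a" using car car' x(2) a(1) by (simp add: a_ac)
      then show ?thesis using car car' by (simp add: a_minus_def a_assoc r_neg)
    qed
    moreover have "a \<in> I N2" "x \<in> I N2" using a x anti[of N2 k] anti[of N2 N] k by (auto simp: N_def)
    ultimately have "x \<ominus> a \<in> I N2 \<inter> J" using Id(6)[of x N2 a] Jd(3)[OF x(3) a(3)] by auto
    then have "x \<ominus> a \<in> I k" using N2[of k] k by (auto simp: N_def)
    then have "x \<ominus> a \<oplus> a \<in> I k" using a Id(3) by blast
    then show ?thesis using car car' by (simp add: a_minus_def a_assoc l_neg)
  qed
  then show "\<exists>N. \<forall>k\<ge>N. I N \<inter> {a \<oplus> b | a b. a \<in> J \<and> b \<in> K} \<subseteq> I k"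
    by blast
qed

text \<open>Pull the chain back along right multiplication by x; preimages of left ideals are left
  ideals.\<close>

lemma dcc_on_times:
  assumes "left_ideal J R" "dcc_on R J" "x \<in> carrier R"
  shows "dcc_on R {a \<otimes> x | a. a \<in> J}"
  unfolding dcc_on_def
proof (intro allI impI)
  fix I :: "nat \<Rightarrow> 'a set"
  assume I: "\<forall>k. left_ideal (I k) R \<and> I (Suc k) \<subseteq> I k"
  note Id = left_idealD[OF I[rule_format, THEN conjunct1]]
  define I' where "I' k = {a \<in> carrier R. a \<otimes> x \<in> I k}" for k
  have "left_ideal (I' k) R" for k
    unfolding I'_def using assms(3) Id
    by (intro left_idealI) (auto simp: l_distr m_assoc)
  moreover have "I' (Suc k) \<subseteq> I' k" for k unfolding I'_def using I by auto
  ultimately obtain N where N: "\<And>k. k \<ge> N \<Longrightarrow> I' N \<inter> J \<subseteq> I' k"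
    using assms(2) unfolding dcc_on_def by blast
  have "I N \<inter> {a \<otimes> x | a. a \<in> J} \<subseteq> I k" if "k \<ge> N" for k
    using N[OF that] left_idealD(1)[OF assms(1)] unfolding I'_def by auto
  then show "\<exists>N. \<forall>k\<ge>N. I N \<inter> {a \<otimes> x | a. a \<in> J} \<subseteq> I k" by blast
qed

text \<open>The union K of all left ideals with the chain condition is closed under sums and right
  multiplication by the two preceding lemmas, so it is a two-sided ideal. It contains M, so
  simplicity puts 1 into K, and a left ideal containing 1 is the whole ring.\<close>

lemma left_artinian_if_minimal_left_ideal:
  assumes "simple_ring R" "minimal_left_ideal R M"
  shows "left_artinian R"
proof -
  define K where "K = {x. \<exists>J. left_ideal J R \<and> dcc_on R J \<and> x \<in> J}"
  have M: "left_ideal M R" "M \<noteq> {\<zero>}" using assms(2) by (auto simp: minimal_left_ideal_def)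
  have MK: "M \<subseteq> K" unfolding K_def using M(1) dcc_on_minimal[OF assms(2)] by blast
  have "left_ideal K R"
  proof (rule left_idealI)
    show "K \<subseteq> carrier R" unfolding K_def using left_idealD(1) by blast
    show "\<zero> \<in> K" using MK left_idealD(2)[OF M(1)] by blast
    show "x \<otimes> a \<in> K" if "x \<in> carrier R" "a \<in> K" for x a
      using that left_idealD(4) unfolding K_def by blast
    show "a \<oplus> b \<in> K" if ab: "a \<in> K" "b \<in> K" for a b
      using that left_ideal_add dcc_on_add unfolding K_def by blast
  qed
  moreover have "right_ideal K R"
  proof (rule right_idealI)
    show "a \<otimes> x \<in> K" if "x \<in> carrier R" "a \<in> K" for x a
      using that left_ideal_times dcc_on_times unfolding K_def by blast
  qed (use left_idealD[OF calculation] in auto)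
  ultimately have "ideal K R" by (simp add: ideal_iff_left_right)
  moreover have "K \<noteq> {\<zero>}" using MK M left_idealD(2)[OF M(1)] by blast
  ultimately have "\<one> \<in> K" using assms(1) unfolding simple_ring_def by blast
  then obtain J where J: "left_ideal J R" "dcc_on R J" "\<one> \<in> J" unfolding K_def by blast
  have "x \<in> J" if "x \<in> carrier R" for x
    using left_idealD(4)[OF J(1) that J(3)] that by simp
  then have J_eq: "I \<inter> J = I" if "left_ideal I R" for I
    using left_idealD(1)[OF that] by blast
  show ?thesis
    unfolding left_artinian_def
  proof (intro conjI notI ring_axioms)
    assume "\<exists>L :: nat \<Rightarrow> 'a set. \<forall>k. left_ideal (L k) R \<and> L (Suc k) \<subset> L k"
    then obtain L :: "nat \<Rightarrow> 'a set" where L: "\<forall>k. left_ideal (L k) R \<and> L (Suc k) \<subset> L k" by blast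
    then obtain N where "\<forall>k\<ge>N. L N \<inter> J \<subseteq> L k"
      using J(2) unfolding dcc_on_def by blast
    then have "L N \<subseteq> L (Suc N)" using J_eq L by auto
    then show False using L by blast
  qed
qed

lemma minimal_left_ideal_eq_principal:
  assumes "minimal_left_ideal R M" "x \<in> M" "x \<noteq> \<zero>"
  shows "M = {r \<otimes> x | r. r \<in> carrier R}"
proof -
  have M: "left_ideal M R" using assms(1) by (simp add: minimal_left_ideal_def)
  have x: "x \<in> carrier R" using left_idealD(1)[OF M] assms(2) by blast
  have "x \<in> {r \<otimes> x | r. r \<in> carrier R}" using x by (auto intro!: exI[of _ \<one>])
  then show ?thesis
    using assms left_ideal_principal[OF x] left_idealD(4)[OF M _ assms(2)]
    unfolding minimal_left_ideal_def by blast
qed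

text \<open>The minimal left ideal is generated by an idempotent \<open>e\<close> with \<open>eRe\<close> a division ring;
  this condition is left-right symmetric, so \<open>eR\<close> is a minimal right ideal.\<close>

lemma simple_minimal_right_ideal:
  assumes "simple_ring R" "minimal_left_ideal R M"
  shows "\<exists>I. minimal_left_ideal (op_ring R) I"
proof -
  have M: "left_ideal M R" and M0: "M \<noteq> {\<zero>}" using assms(2) by (auto simp: minimal_left_ideal_def)
  note Md = left_idealD[OF M]
  have Mc [simp]: "m \<in> carrier R" if "m \<in> M" for m using Md(1) that by blast
  \<comment> \<open>The annihilator of M is two-sided and proper, hence zero: M is a faithful
    module.\<close>
  define Z where "Z = {x \<in> carrier R. \<forall>m\<in>M. x \<otimes> m = \<zero>}"
  have "left_ideal Z R"
    by (rule left_idealI) (auto simp: Z_def l_distr m_assoc)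
  moreover have "right_ideal Z R"
    using Md(4) by (intro right_idealI) (auto simp: Z_def l_distr m_assoc)
  ultimately have "ideal Z R" by (simp add: ideal_iff_left_right)
  moreover have "Z \<noteq> carrier R"
  proof
    assume "Z = carrier R"
    then have "\<one> \<in> Z" by simp
    then have "\<forall>m\<in>M. m = \<zero>" unfolding Z_def by auto
    then show False using M0 Md(2) by blast
  qed
  ultimately have Z0: "Z = {\<zero>}" using assms(1) unfolding simple_ring_def by blast
  have faithful: "\<exists>m\<in>M. x \<otimes> m \<noteq> \<zero>" if "x \<in> carrier R" "x \<noteq> \<zero>" for x
    using that Z0 unfolding Z_def by blast
  have princ: "\<exists>r\<in>carrier R. y = r \<otimes> x" if "x \<in> M" "x \<noteq> \<zero>" "y \<in> M" for x y
    using minimal_left_ideal_eq_principal[OF assms(2) that(1,2)] that(3) by blast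
  obtain b where b: "b \<in> M" "b \<noteq> \<zero>" using M0 Md(2) by blast
  obtain a where a: "a \<in> M" "b \<otimes> a \<noteq> \<zero>" using faithful[of b] b by auto
  have a0: "a \<noteq> \<zero>" using a b by auto
  \<comment> \<open>Right multiplication by a does not kill all of M, so by minimality of M it is
    injective on M; this turns e a = a into m e = m for all m in M.\<close>
  define K where "K = {m \<in> M. m \<otimes> a = \<zero>}"
  have "left_ideal K R"
    using Md(2,3,4) a(1) by (intro left_idealI) (auto simp: K_def l_distr m_assoc)
  moreover have "K \<subseteq> M" "K \<noteq> M" unfolding K_def using a b by auto
  ultimately have K0: "K = {\<zero>}" using assms(2) unfolding minimal_left_ideal_def by blast
  have "\<exists>e\<in>M. e \<otimes> a = a"
  proof -
    obtain r where "r \<in> carrier R" "a = r \<otimes> (b \<otimes> a)"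
      using princ[of "b \<otimes> a" a] a b Md(4)[of b a] by auto
    then show ?thesis using b a Md(4) by (intro bexI[of _ "r \<otimes> b"]) (auto simp: m_assoc)
  qed
  then obtain e where e: "e \<in> M" "e \<otimes> a = a" by blast
  have Me: "m \<otimes> e = m" if "m \<in> M" for m
  proof -
    have "(m \<otimes> e \<ominus> m) \<otimes> a = \<zero>"
      using that e a(1) by (simp add: a_minus_def l_distr m_assoc l_minus r_neg)
    moreover have "m \<otimes> e \<ominus> m \<in> M" using that e Md(4,6) by auto
    ultimately have "m \<otimes> e \<ominus> m = \<zero>" using K0 unfolding K_def by blast
    then show ?thesis using that e add_minus_eq_zeroD[of "m \<otimes> e" m] by simp
  qed
  have e0: "e \<noteq> \<zero>" using e(2) a0 a(1) l_null Mc by metis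
  define E where "E = {e \<otimes> x | x. x \<in> carrier R}"
  have rE: "right_ideal E R"
    using nc_ring.left_ideal_principal[OF nc_ring_op_ring, of e] e by (simp add: E_def)
  have min: "I = {\<zero>} \<or> I = E" if I: "right_ideal I R" "I \<subseteq> E" for I
  proof (rule disjCI)
    note Id = right_idealD[OF I(1)]
    assume "I \<noteq> E"
    show "I = {\<zero>}"
    proof (rule ccontr)
      assume "I \<noteq> {\<zero>}"
      then obtain y where y: "y \<in> I" "y \<noteq> \<zero>" using Id(2) by blast
      have yc: "y \<in> carrier R" using y Id(1) by blast
      obtain x where "y = e \<otimes> x" "x \<in> carrier R" using y I(2) unfolding E_def by blast
      then have ey: "e \<otimes> y = y" using e Me[OF e(1)] by (simp add: m_assoc[symmetric])
      obtain m where m: "m \<in> M" "y \<otimes> m \<noteq> \<zero>" using faithful y yc by blast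
      \<comment> \<open>Since y = e y and m e = m, the nonzero element d lies in eRe. The aim is an
        inverse of d there: it exhibits e as a right multiple of y.\<close>
      define d where "d = y \<otimes> m"
      have d: "d \<in> M" "d \<noteq> \<zero>" "e \<otimes> d = d" "d \<otimes> e = d"
        using m yc Md(4) e(1) Me by (auto simp: d_def m_assoc[symmetric] ey)
      obtain w where w: "w \<in> carrier R" "e = w \<otimes> d" using princ[OF d(1,2) e(1)] by blast
      \<comment> \<open>Compressing by e on both sides moves the left inverse w of d into eRe, where
        e is the identity.\<close>
      define w' where "w' = e \<otimes> w \<otimes> e"
      have ee: "e \<otimes> e = e" using Me[OF e(1)] .
      have ec: "e \<in> carrier R" "d \<in> carrier R" using e(1) d(1) by auto
      have w': "w' \<in> M" "w' \<otimes> d = e" "e \<otimes> w' = w'"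
      proof -
        show "w' \<in> M" unfolding w'_def using ec w(1) e(1) Md(4) by blast
        have "w' \<otimes> d = e \<otimes> (w \<otimes> (e \<otimes> d))" unfolding w'_def using ec w(1) by (simp add: m_assoc)
        also have "\<dots> = e \<otimes> (w \<otimes> d)" by (simp only: d(3))
        also have "\<dots> = e" by (simp only: w(2)[symmetric] ee)
        finally show "w' \<otimes> d = e" .
        have "e \<otimes> w' = (e \<otimes> e) \<otimes> (w \<otimes> e)" unfolding w'_def using ec w(1) by (simp add: m_assoc)
        then show "e \<otimes> w' = w'" unfolding w'_def ee using ec w(1) by (simp add: m_assoc)
      qed
      have "w' \<noteq> \<zero>" using w'(2) e0 l_null[OF ec(2)] by metis
      then obtain v where v: "v \<in> carrier R" "e = v \<otimes> w'" using princ[OF w'(1) _ e(1)] by blast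
      \<comment> \<open>In the same way w' has a left inverse v' in eRe. Then v' = v' w' d = d, so
        w' is a two-sided inverse of d.\<close>
      define v' where "v' = e \<otimes> v \<otimes> e"
      have v': "v' \<in> carrier R" "v' \<otimes> w' = e" "v' \<otimes> e = v'"
      proof -
        show "v' \<in> carrier R" unfolding v'_def using ec v(1) by simp
        have "v' \<otimes> w' = e \<otimes> (v \<otimes> (e \<otimes> w'))"
          unfolding v'_def using ec v(1) Mc[OF w'(1)] by (simp add: m_assoc)
        also have "\<dots> = e" by (simp only: w'(3) v(2)[symmetric] ee)
        finally show "v' \<otimes> w' = e" .
        show "v' \<otimes> e = v'" unfolding v'_def using ec v(1) by (simp add: m_assoc ee)
      qed
      have "d = v' \<otimes> w' \<otimes> d" by (simp only: v'(2) d(3))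
      also have "\<dots> = v' \<otimes> (w' \<otimes> d)" using ec v'(1) Mc[OF w'(1)] by (simp add: m_assoc)
      also have "\<dots> = v'" by (simp only: w'(2) v'(3))
      finally have "y \<otimes> (m \<otimes> w') = e"
        using v'(2) m yc Mc[OF w'(1)] m_assoc[of y m w'] by (simp add: d_def)
      then have "e \<in> I" using Id(3)[OF _ y(1), of "m \<otimes> w'"] m w' by auto
      then have "E \<subseteq> I" unfolding E_def using Id(3) by blast
      then show False using I(2) \<open>I \<noteq> E\<close> by blast
    qed
  qed
  have "E \<noteq> {\<zero>}" using e0 e(1) unfolding E_def by (auto intro!: exI[of _ \<one>] dest!: equalityD1)
  then show ?thesis
    unfolding minimal_left_ideal_def using rE min by (intro exI[of _ E]) simp
qed

text \<open>The chain condition provides a minimal left ideal, symmetry of the idempotent condition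
  a minimal right ideal, and for a simple ring the latter gives back the chain condition on the
  right.\<close>

lemma simple_artinian_op_ring:
  assumes "simple_artinian R"
  shows "simple_artinian (op_ring R)"
proof -
  have s: "simple_ring R" and l: "left_artinian R" using assms by (auto simp: simple_artinian_def)
  have "carrier R \<noteq> {\<zero>}" using s by (simp add: simple_ring_def)
  then obtain M where "left_ideal M R" "M \<noteq> {\<zero>}"
    "\<And>K. left_ideal K R \<Longrightarrow> K \<noteq> {\<zero>} \<Longrightarrow> \<not> K \<subset> M"
    using left_artinian_minimal[OF l left_ideal_carrier, of "\<lambda>I. I \<noteq> {\<zero>}"] by blast
  then have "minimal_left_ideal R M" unfolding minimal_left_ideal_def by blast
  then obtain I where "minimal_left_ideal (op_ring R) I"
    using simple_minimal_right_ideal s by blast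
  then have "left_artinian (op_ring R)"
    using nc_ring.left_artinian_if_minimal_left_ideal[OF nc_ring_op_ring] s by simp
  then show ?thesis using s by (simp add: simple_artinian_def)
qed

end

section \<open>Rings of left fractions\<close>

text \<open>\<open>frac\<close> is stated with the denominator cleared, which is the form that all
  computations use. D is a parameter of its own so that the locale covers R with S, R/ker with the
  image of S, and the opposite rings.\<close>

locale left_fractions = ring_hom_ring R Q h
  for R :: "'a ring" (structure) and Q :: "'b ring" (structure) and h +
  fixes D :: "'a set"
  assumes D_subset: "D \<subseteq> carrier R"
    and one_D: "\<one> \<in> D"
    and mult_D: "\<And>s t. s \<in> D \<Longrightarrow> t \<in> D \<Longrightarrow> s \<otimes> t \<in> D"
    and D_Units: "\<And>s. s \<in> D \<Longrightarrow> h s \<in> Units Q"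
    and frac: "\<And>q. q \<in> carrier Q \<Longrightarrow> \<exists>s\<in>D. \<exists>r\<in>carrier R. h s \<otimes>\<^bsub>Q\<^esub> q = h r"
begin

sublocale nR: nc_ring R by (simp add: nc_ring_iff R.ring_axioms)
sublocale nQ: nc_ring Q by (simp add: nc_ring_iff S.ring_axioms)

lemma D_carrier [simp]: "s \<in> D \<Longrightarrow> s \<in> carrier R"
  using D_subset by blast

lemma Units_cancel:
  assumes "u \<in> Units Q" "x \<in> carrier Q" "y \<in> carrier Q" "u \<otimes>\<^bsub>Q\<^esub> x = u \<otimes>\<^bsub>Q\<^esub> y"
  shows "x = y"
  using assms S.Units_l_cancel by blast

lemma Units_cancel_zero:
  assumes "u \<in> Units Q" "x \<in> carrier Q" "u \<otimes>\<^bsub>Q\<^esub> x = \<zero>\<^bsub>Q\<^esub>"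
  shows "x = \<zero>\<^bsub>Q\<^esub>"
  by (rule Units_cancel[OF assms(1)]) (use assms in \<open>auto simp: S.Units_closed\<close>)

text \<open>This is the left ideal QJ. For a left ideal J one fraction per element is enough, since
  two fractions can be brought to a common denominator.\<close>

definition ext :: "'a set \<Rightarrow> 'b set" where
  "ext J = {q \<in> carrier Q. \<exists>s\<in>D. \<exists>b\<in>J. h s \<otimes>\<^bsub>Q\<^esub> q = h b}"

lemma extI: "q \<in> carrier Q \<Longrightarrow> s \<in> D \<Longrightarrow> b \<in> J \<Longrightarrow> h s \<otimes>\<^bsub>Q\<^esub> q = h b \<Longrightarrow> q \<in> ext J"
  unfolding ext_def by blast

text \<open>Write h(s1) times the inverse of h(s2) as a left fraction with denominator s3 and
  numerator r3. Then s3 s1 and r3 s2 agree under h, and s3 s1 serves both elements.\<close>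

lemma ext_common_denominator:
  assumes "left_ideal J R" "q1 \<in> ext J" "q2 \<in> ext J"
  shows "\<exists>s\<in>D. \<exists>b1\<in>J. \<exists>b2\<in>J. h s \<otimes>\<^bsub>Q\<^esub> q1 = h b1 \<and> h s \<otimes>\<^bsub>Q\<^esub> q2 = h b2"
proof -
  note J = nR.left_idealD[OF assms(1)]
  obtain s1 b1 where 1: "s1 \<in> D" "b1 \<in> J" "h s1 \<otimes>\<^bsub>Q\<^esub> q1 = h b1" and q1: "q1 \<in> carrier Q"
    using assms(2) unfolding ext_def by blast
  obtain s2 b2 where 2: "s2 \<in> D" "b2 \<in> J" "h s2 \<otimes>\<^bsub>Q\<^esub> q2 = h b2" and q2: "q2 \<in> carrier Q"
    using assms(3) unfolding ext_def by blast
  have b: "b1 \<in> carrier R" "b2 \<in> carrier R" using J 1 2 by blast+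
  have i2: "inv\<^bsub>Q\<^esub> (h s2) \<in> carrier Q" using D_Units[OF 2(1)] by simp
  obtain s3 r3 where 3: "s3 \<in> D" "r3 \<in> carrier R"
    "h s3 \<otimes>\<^bsub>Q\<^esub> (h s1 \<otimes>\<^bsub>Q\<^esub> inv\<^bsub>Q\<^esub> (h s2)) = h r3"
    using frac[of "h s1 \<otimes>\<^bsub>Q\<^esub> inv\<^bsub>Q\<^esub> (h s2)"] 1(1) i2 by auto
  have "h (s3 \<otimes> s1) \<otimes>\<^bsub>Q\<^esub> q1 = h (s3 \<otimes> b1)"
    using 1 3 q1 b by (simp add: S.m_assoc)
  moreover have "h (s3 \<otimes> s1) \<otimes>\<^bsub>Q\<^esub> q2 = h (r3 \<otimes> b2)"
  proof -
    have "h (r3 \<otimes> b2) = h s3 \<otimes>\<^bsub>Q\<^esub> (h s1 \<otimes>\<^bsub>Q\<^esub> ((inv\<^bsub>Q\<^esub> (h s2) \<otimes>\<^bsub>Q\<^esub> h s2) \<otimes>\<^bsub>Q\<^esub> q2))"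
      using 1(1) 2(1) 3(1,2) b i2 q2 by (simp add: 3(3)[symmetric] 2(3)[symmetric] S.m_assoc)
    also have "\<dots> = h (s3 \<otimes> s1) \<otimes>\<^bsub>Q\<^esub> q2"
      using 1(1) 3(1) q2 D_Units[OF 2(1)] by (simp add: S.m_assoc)
    finally show ?thesis by simp
  qed
  ultimately show ?thesis
    using J(4)[OF _ 1(2), of s3] J(4)[OF 3(2) 2(2)] mult_D[OF 3(1) 1(1)] 3(1)
      D_carrier by blast
qed

lemma ext_superset: "J \<subseteq> carrier R \<Longrightarrow> b \<in> J \<Longrightarrow> h b \<in> ext J"
  by (rule extI[OF _ one_D, of _ b]) auto

lemma left_ideal_ext:
  assumes "left_ideal J R"
  shows "left_ideal (ext J) Q"
proof (rule nQ.left_idealI)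
  note J = nR.left_idealD[OF assms]
  show "ext J \<subseteq> carrier Q" unfolding ext_def by blast
  show "\<zero>\<^bsub>Q\<^esub> \<in> ext J" using ext_superset[OF J(1,2)] by simp
  fix x y assume "x \<in> ext J" "y \<in> ext J"
  moreover obtain s b1 b2 where "s \<in> D" "b1 \<in> J" "b2 \<in> J"
    "h s \<otimes>\<^bsub>Q\<^esub> x = h b1" "h s \<otimes>\<^bsub>Q\<^esub> y = h b2"
    using ext_common_denominator[OF assms calculation] by blast
  moreover have "b1 \<in> carrier R" "b2 \<in> carrier R" using calculation J(1) by blast+
  moreover have "b1 \<oplus> b2 \<in> J" using calculation J(3) by blast
  ultimately show "x \<oplus>\<^bsub>Q\<^esub> y \<in> ext J"
    by (intro extI[of _ s "b1 \<oplus> b2"]) (auto simp: S.r_distr ext_def)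
next
  note J = nR.left_idealD[OF assms]
  fix q x assume q: "q \<in> carrier Q" and "x \<in> ext J"
  then obtain s b where b: "s \<in> D" "b \<in> J" "h s \<otimes>\<^bsub>Q\<^esub> x = h b" and x: "x \<in> carrier Q"
    unfolding ext_def by blast
  have i: "inv\<^bsub>Q\<^esub> (h s) \<in> carrier Q" using D_Units[OF b(1)] by simp
  \<comment> \<open>Moves the denominator s of x to the left of q, at the price of a new denominator
    t.\<close>
  obtain t r where t: "t \<in> D" "r \<in> carrier R" "h t \<otimes>\<^bsub>Q\<^esub> (q \<otimes>\<^bsub>Q\<^esub> inv\<^bsub>Q\<^esub> (h s)) = h r"
    using frac[of "q \<otimes>\<^bsub>Q\<^esub> inv\<^bsub>Q\<^esub> (h s)"] q i by blast
  have bc: "b \<in> carrier R" using b J(1) by blast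
  have "h (r \<otimes> b) = h t \<otimes>\<^bsub>Q\<^esub> (q \<otimes>\<^bsub>Q\<^esub> ((inv\<^bsub>Q\<^esub> (h s) \<otimes>\<^bsub>Q\<^esub> h s) \<otimes>\<^bsub>Q\<^esub> x))"
    using b(1) t(1,2) bc i q x by (simp add: t(3)[symmetric] b(3)[symmetric] S.m_assoc)
  also have "\<dots> = h t \<otimes>\<^bsub>Q\<^esub> (q \<otimes>\<^bsub>Q\<^esub> x)"
    using x D_Units[OF b(1)] by simp
  finally show "q \<otimes>\<^bsub>Q\<^esub> x \<in> ext J"
    using q x by (intro extI[OF _ t(1) J(4)[OF t(2) b(2)]]) simp_all
qed

lemma ext_times_h:
  assumes "right_ideal J R" "x \<in> ext J" "r \<in> carrier R"
  shows "x \<otimes>\<^bsub>Q\<^esub> h r \<in> ext J"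
proof -
  note J = nR.right_idealD[OF assms(1)]
  obtain s b where b: "s \<in> D" "b \<in> J" "h s \<otimes>\<^bsub>Q\<^esub> x = h b" and x: "x \<in> carrier Q"
    using assms(2) unfolding ext_def by blast
  have bc: "b \<in> carrier R" using b J(1) by blast
  have "h s \<otimes>\<^bsub>Q\<^esub> (x \<otimes>\<^bsub>Q\<^esub> h r) = h (b \<otimes> r)"
    using b(1) x assms(3) bc by (simp add: S.m_assoc[symmetric] b(3))
  then show ?thesis unfolding ext_def using b J(3) assms(3) x by auto
qed

text \<open>A descending chain \<open>X \<supseteq> X h(t) \<supseteq> X h(t)\<^sup>2 \<supseteq> \<dots>\<close> must stabilize, so right multiplication by
  inverses of denominators preserves \<open>X = ext J\<close>.\<close>

lemma ideal_ext:
  assumes "ideal J R" "left_artinian Q"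
  shows "ideal (ext J) Q"
proof -
  have l: "left_ideal J R" and r: "right_ideal J R"
    using assms(1) by (auto simp: nR.ideal_iff_left_right)
  have lX: "left_ideal (ext J) Q" using left_ideal_ext[OF l] .
  have X: "x \<in> carrier Q" if "x \<in> ext J" for x using that unfolding ext_def by blast
  have inv_step: "x \<otimes>\<^bsub>Q\<^esub> inv\<^bsub>Q\<^esub> (h t) \<in> ext J" if x: "x \<in> ext J" and t: "t \<in> D" for x t
  proof -
    define L where "L k = {y \<otimes>\<^bsub>Q\<^esub> h t [^]\<^bsub>Q\<^esub> k | y. y \<in> ext J}" for k :: nat
    have tc: "h t \<in> carrier Q" using t by simp
    have tU: "h t [^]\<^bsub>Q\<^esub> k \<in> Units Q" for k :: nat
      using D_Units[OF t] by (rule S.Units_pow_closed)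
    have "left_ideal (L k) Q" for k
      unfolding L_def using lX tc by (intro nQ.left_ideal_times) auto
    moreover have "L (Suc k) \<subseteq> L k" for k
    proof
      fix z assume "z \<in> L (Suc k)"
      then obtain y where y: "y \<in> ext J" "z = y \<otimes>\<^bsub>Q\<^esub> h t [^]\<^bsub>Q\<^esub> Suc k" unfolding L_def by blast
      then have "z = (y \<otimes>\<^bsub>Q\<^esub> h t) \<otimes>\<^bsub>Q\<^esub> h t [^]\<^bsub>Q\<^esub> k"
        using S.nat_pow_Suc2[OF tc, of k] tc X[OF y(1)] by (simp add: S.m_assoc del: S.nat_pow_Suc)
      then show "z \<in> L k" unfolding L_def using ext_times_h[OF r y(1)] t by auto
    qed
    ultimately obtain k where "L (Suc k) = L k"
      using nQ.left_artinian_stable[OF assms(2)] by metis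
    moreover have "x \<otimes>\<^bsub>Q\<^esub> h t [^]\<^bsub>Q\<^esub> k \<in> L k" unfolding L_def using x by blast
    ultimately obtain y where y: "y \<in> ext J"
      "x \<otimes>\<^bsub>Q\<^esub> h t [^]\<^bsub>Q\<^esub> k = y \<otimes>\<^bsub>Q\<^esub> h t [^]\<^bsub>Q\<^esub> Suc k"
      unfolding L_def by blast
    \<comment> \<open>The power of h(t) is a unit, so cancelling it on the right leaves x = y h(t),
      and y is the wanted quotient.\<close>
    then have "x \<otimes>\<^bsub>Q\<^esub> h t [^]\<^bsub>Q\<^esub> k = (y \<otimes>\<^bsub>Q\<^esub> h t) \<otimes>\<^bsub>Q\<^esub> h t [^]\<^bsub>Q\<^esub> k"
      using S.nat_pow_Suc2[OF tc, of k] tc X[OF y(1)] by (simp add: S.m_assoc del: S.nat_pow_Suc)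
    then have "x \<otimes>\<^bsub>Q\<^esub> h t [^]\<^bsub>Q\<^esub> k \<otimes>\<^bsub>Q\<^esub> inv\<^bsub>Q\<^esub> (h t [^]\<^bsub>Q\<^esub> k)
        = (y \<otimes>\<^bsub>Q\<^esub> h t) \<otimes>\<^bsub>Q\<^esub> h t [^]\<^bsub>Q\<^esub> k \<otimes>\<^bsub>Q\<^esub> inv\<^bsub>Q\<^esub> (h t [^]\<^bsub>Q\<^esub> k)"
      by (rule arg_cong)
    then have "x = y \<otimes>\<^bsub>Q\<^esub> h t"
      using tU[of k] tc X[OF x] X[OF y(1)] by (simp add: S.m_assoc)
    then have "x \<otimes>\<^bsub>Q\<^esub> inv\<^bsub>Q\<^esub> (h t) = y"
      using D_Units[OF t] tc X[OF y(1)] by (simp add: S.m_assoc)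
    then show ?thesis using y by simp
  qed
  have "right_ideal (ext J) Q"
  proof (rule nQ.right_idealI)
    fix q x assume q: "q \<in> carrier Q" and x: "x \<in> ext J"
    \<comment> \<open>q is the inverse of h(s) followed by h(r), and \<open>ext J\<close> is closed
      under right multiplication by both kinds of factors.\<close>
    obtain s r where s: "s \<in> D" "r \<in> carrier R" "h s \<otimes>\<^bsub>Q\<^esub> q = h r" using frac[OF q] by blast
    have "x \<otimes>\<^bsub>Q\<^esub> inv\<^bsub>Q\<^esub> (h s) \<otimes>\<^bsub>Q\<^esub> h r \<in> ext J"
      using ext_times_h[OF \<open>right_ideal J R\<close> inv_step[OF x s(1)] s(2)] .
    moreover have "x \<otimes>\<^bsub>Q\<^esub> inv\<^bsub>Q\<^esub> (h s) \<otimes>\<^bsub>Q\<^esub> h r = x \<otimes>\<^bsub>Q\<^esub> ((inv\<^bsub>Q\<^esub> (h s) \<otimes>\<^bsub>Q\<^esub> h s) \<otimes>\<^bsub>Q\<^esub> q)"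
      using D_Units[OF s(1)] s(1) q X[OF x] by (simp add: s(3)[symmetric] S.m_assoc del: S.Units_l_inv)
    ultimately show "x \<otimes>\<^bsub>Q\<^esub> q \<in> ext J"
      using D_Units[OF s(1)] q by simp
  qed (use nQ.left_idealD[OF lX] in auto)
  then show ?thesis using lX by (simp add: nQ.ideal_iff_left_right)
qed

end

section \<open>Simple Artinian rings of left fractions: prime kernel and units\<close>

locale simple_left_fractions = left_fractions +
  assumes simple_artinian: "simple_artinian Q"
begin

lemma simple_Q: "simple_ring Q" and left_artinian_Q: "left_artinian Q"
  using simple_artinian by (auto simp: simple_artinian_def)

lemma one_not_zero_Q: "\<one>\<^bsub>Q\<^esub> \<noteq> \<zero>\<^bsub>Q\<^esub>"
  using simple_Q S.one_zeroD unfolding simple_ring_def by blast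

text \<open>\<open>ext J\<close> is a nonzero ideal, hence contains 1; clearing the denominator of 1
  gives c in J with the same image as some s in D.\<close>

lemma ideal_meets_D:
  assumes "ideal J R" "b \<in> J" "h b \<noteq> \<zero>\<^bsub>Q\<^esub>"
  shows "\<exists>s\<in>D. \<exists>c\<in>J. h c = h s"
proof -
  have "J \<subseteq> carrier R" using assms(1) nR.left_idealD(1) nR.ideal_iff_left_right by blast
  then have "ext J \<noteq> {\<zero>\<^bsub>Q\<^esub>}" using ext_superset assms(2,3) by blast
  then have "\<one>\<^bsub>Q\<^esub> \<in> ext J"
    using simple_Q ideal_ext[OF assms(1) left_artinian_Q] unfolding simple_ring_def by blast
  then obtain s c where "s \<in> D" "c \<in> J" "h s \<otimes>\<^bsub>Q\<^esub> \<one>\<^bsub>Q\<^esub> = h c" unfolding ext_def by blast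
  then show ?thesis by (intro bexI[of _ s] bexI[of _ c]) auto
qed

lemma a_kernel_eq: "a_kernel R Q h = {x \<in> carrier R. h x = \<zero>\<^bsub>Q\<^esub>}"
  by (rule a_kernel_def')

text \<open>If J is not inside the kernel, it contains c whose image is a unit, and h(a) h(c) = 0
  then forces h(a) = 0 for every a in I.\<close>

lemma prime_kernel: "nc_prime R (a_kernel R Q h)"
  unfolding nc_prime_def
proof (intro conjI allI impI)
  show "ideal (a_kernel R Q h) R" by (rule kernel_is_ideal)
  show "a_kernel R Q h \<noteq> carrier R"
    using one_not_zero_Q R.one_closed unfolding a_kernel_eq by force
  fix I J assume *: "ideal I R \<and> ideal J R \<and> (\<forall>a\<in>I. \<forall>b\<in>J. a \<otimes> b \<in> a_kernel R Q h)"
  then have sub: "I \<subseteq> carrier R" "J \<subseteq> carrier R"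
    using nR.left_idealD(1) nR.ideal_iff_left_right by blast+
  show "I \<subseteq> a_kernel R Q h \<or> J \<subseteq> a_kernel R Q h"
  proof (rule disjCI)
    assume "\<not> J \<subseteq> a_kernel R Q h"
    then obtain b where "b \<in> J" "h b \<noteq> \<zero>\<^bsub>Q\<^esub>" using sub unfolding a_kernel_eq by blast
    then obtain s c where c: "s \<in> D" "c \<in> J" "h c = h s" using ideal_meets_D * by blast
    show "I \<subseteq> a_kernel R Q h"
    proof
      fix a assume a: "a \<in> I"
      have ac: "a \<in> carrier R" "c \<in> carrier R" using a c sub by blast+
      have "h a \<otimes>\<^bsub>Q\<^esub> h s = \<zero>\<^bsub>Q\<^esub>" using * a c ac unfolding a_kernel_eq by force
      then have "h a \<otimes>\<^bsub>Q\<^esub> h s \<otimes>\<^bsub>Q\<^esub> inv\<^bsub>Q\<^esub> (h s) = \<zero>\<^bsub>Q\<^esub>"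
        using D_Units[OF c(1)] by simp
      then have "h a = \<zero>\<^bsub>Q\<^esub>" using D_Units[OF c(1)] ac c(1) by (simp add: S.m_assoc)
      then show "a \<in> a_kernel R Q h" unfolding a_kernel_eq using ac by blast
    qed
  qed
qed

text \<open>A left annihilator of h(c) in Q becomes the image of an element of R once its
  denominator is cleared, so it is enough to test elements of R modulo the kernel.\<close>

lemma h_Units:
  assumes "c \<in> carrier R"
    and "\<And>r. r \<in> carrier R \<Longrightarrow> h (r \<otimes> c) = \<zero>\<^bsub>Q\<^esub> \<Longrightarrow> h r = \<zero>\<^bsub>Q\<^esub>"
  shows "h c \<in> Units Q"
proof (rule nQ.left_artinian_Units[OF left_artinian_Q])
  show "h c \<in> carrier Q" using assms(1) by simp
  fix x assume x: "x \<in> carrier Q" "x \<otimes>\<^bsub>Q\<^esub> h c = \<zero>\<^bsub>Q\<^esub>"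
  obtain s r where s: "s \<in> D" "r \<in> carrier R" "h s \<otimes>\<^bsub>Q\<^esub> x = h r" using frac[OF x(1)] by blast
  have "h (r \<otimes> c) = h s \<otimes>\<^bsub>Q\<^esub> (x \<otimes>\<^bsub>Q\<^esub> h c)"
    using s(1,2) x(1) assms(1) by (simp add: s(3)[symmetric] S.m_assoc)
  then have "h r = \<zero>\<^bsub>Q\<^esub>" using assms(2)[OF s(2)] x(2) s(1) by simp
  then show "x = \<zero>\<^bsub>Q\<^esub>" using Units_cancel_zero[OF D_Units[OF s(1)] x(1)] s(3) by simp
qed

end

section \<open>The injective case: classical quotient ring and Goldie conditions\<close>

locale injective_left_fractions = simple_left_fractions +
  assumes inj: "inj_on h (carrier R)"
begin

lemma h_zeroD: "x \<in> carrier R \<Longrightarrow> h x = \<zero>\<^bsub>Q\<^esub> \<Longrightarrow> x = \<zero>"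
  using inj inj_onD[of h "carrier R" x \<zero>] by simp

lemma regular_Units: "c \<in> regular R \<Longrightarrow> h c \<in> Units Q"
proof (rule h_Units)
  assume c: "c \<in> regular R"
  then show cc: "c \<in> carrier R" by (simp add: regular_def)
  fix r assume r: "r \<in> carrier R" "h (r \<otimes> c) = \<zero>\<^bsub>Q\<^esub>"
  then have "r \<otimes> c = \<zero>" using h_zeroD[of "r \<otimes> c"] cc by blast
  then have "r = \<zero>" using c r(1) unfolding regular_def by blast
  then show "h r = \<zero>\<^bsub>Q\<^esub>" by simp
qed

lemma Units_regular:
  assumes "c \<in> carrier R" "h c \<in> Units Q"
  shows "c \<in> regular R"
  unfolding regular_def
proof (intro CollectI conjI ballI impI assms(1))
  fix x assume x: "x \<in> carrier R"
  show "x = \<zero>" if "c \<otimes> x = \<zero>"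
  proof -
    have "h c \<otimes>\<^bsub>Q\<^esub> h x = \<zero>\<^bsub>Q\<^esub>" using that x assms(1) by (metis hom_mult hom_zero)
    then show ?thesis using Units_cancel_zero[OF assms(2)] x h_zeroD by simp
  qed
  show "x = \<zero>" if "x \<otimes> c = \<zero>"
  proof -
    have "h x \<otimes>\<^bsub>Q\<^esub> h c \<otimes>\<^bsub>Q\<^esub> inv\<^bsub>Q\<^esub> (h c) = \<zero>\<^bsub>Q\<^esub>"
      using that x assms by (metis hom_mult hom_zero S.l_null S.Units_inv_closed)
    then have "h x = \<zero>\<^bsub>Q\<^esub>" using x assms by (simp add: S.m_assoc)
    then show ?thesis using x h_zeroD by simp
  qed
qed

lemma is_lcq: "is_lcq R Q h"
  unfolding is_lcq_def
proof (intro conjI S.ring_axioms homh inj ballI)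
  show "h ` regular R \<subseteq> Units Q" using regular_Units by blast
  fix q assume q: "q \<in> carrier Q"
  obtain s r where s: "s \<in> D" "r \<in> carrier R" "h s \<otimes>\<^bsub>Q\<^esub> q = h r" using frac[OF q] by blast
  have "q = inv\<^bsub>Q\<^esub> (h s) \<otimes>\<^bsub>Q\<^esub> h r"
    using s(1) q D_Units[OF s(1)] by (simp add: s(3)[symmetric] S.m_assoc[symmetric])
  then show "\<exists>c\<in>regular R. \<exists>a\<in>carrier R. q = inv\<^bsub>Q\<^esub> (h c) \<otimes>\<^bsub>Q\<^esub> h a"
    using s Units_regular[OF _ D_Units[OF s(1)]] by auto
qed

text \<open>The kernel of h is zero here, so R is even prime.\<close>

lemma semiprime: "semiprime R"
  unfolding semiprime_def
proof (intro conjI R.ring_axioms allI impI)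
  fix I assume I: "ideal I R \<and> (\<forall>a\<in>I. \<forall>b\<in>I. a \<otimes> b = \<zero>)"
  have "a_kernel R Q h = {\<zero>}" unfolding a_kernel_eq using h_zeroD by auto
  moreover have "\<forall>a\<in>I. \<forall>b\<in>I. a \<otimes> b \<in> {\<zero>}" using I by simp
  ultimately have "I \<subseteq> {\<zero>}" using prime_kernel I unfolding nc_prime_def by metis
  moreover have "\<zero> \<in> I" using I nR.left_idealD(2) nR.ideal_iff_left_right by blast
  ultimately show "I = {\<zero>}" by blast
qed

text \<open>Right annihilators in Q of the images of L k form a descending chain of right ideals,
  which stabilizes because Q is also right Artinian. As L k annihilates Y, the image of Y lies in M
  k = M (Suc k), so L (Suc k) annihilates Y as well and cannot be larger than L k.\<close>

lemma no_ascending_left_annihilators: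
  "\<not> (\<exists>L :: nat \<Rightarrow> 'a set. \<forall>k. (\<exists>Y \<subseteq> carrier R. L k = l_ann R Y) \<and> L k \<subset> L (Suc k))"
proof
  assume "\<exists>L :: nat \<Rightarrow> 'a set. \<forall>k. (\<exists>Y \<subseteq> carrier R. L k = l_ann R Y) \<and> L k \<subset> L (Suc k)"
  then obtain L :: "nat \<Rightarrow> 'a set" where
    "\<forall>k. (\<exists>Y \<subseteq> carrier R. L k = l_ann R Y) \<and> L k \<subset> L (Suc k)" by (rule exE)
  then have L: "\<exists>Y \<subseteq> carrier R. L k = l_ann R Y" "L k \<subset> L (Suc k)" for k by simp_all
  have Lc: "L k \<subseteq> carrier R" for k using L(1)[of k] unfolding l_ann_def by blast
  define M where "M k = r_ann Q (h ` L k)" for k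
  have rM: "right_ideal (M k) Q" for k
    using Lc[of k] by (intro nQ.right_idealI)
      (auto simp: M_def r_ann_def S.r_distr S.m_assoc[symmetric] subset_iff)
  have sM: "M (Suc k) \<subseteq> M k" for k unfolding M_def r_ann_def using L(2)[of k] by blast
  have "left_artinian (op_ring Q)"
    using nQ.simple_artinian_op_ring[OF simple_artinian] by (simp add: simple_artinian_def)
  then obtain k where k: "M (Suc k) = M k"
    by (rule nc_ring.left_artinian_stable[OF nQ.nc_ring_op_ring, of M]) (use rM sM in auto)
  obtain Y where Y: "Y \<subseteq> carrier R" "L k = l_ann R Y" using L(1) by blast
  have "L (Suc k) \<subseteq> l_ann R Y"
  proof
    fix a assume a: "a \<in> L (Suc k)"
    have "a \<otimes> y = \<zero>" if y: "y \<in> Y" for y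
    proof -
      have yc: "y \<in> carrier R" using y Y by blast
      have "h b \<otimes>\<^bsub>Q\<^esub> h y = \<zero>\<^bsub>Q\<^esub>" if "b \<in> L k" for b
        using that y yc Lc[of k] Y(2) unfolding l_ann_def by (metis (mono_tags, lifting) hom_mult hom_zero mem_Collect_eq)
      then have "h y \<in> M k" unfolding M_def r_ann_def using yc by auto
      then have "h a \<otimes>\<^bsub>Q\<^esub> h y = \<zero>\<^bsub>Q\<^esub>" using a k unfolding M_def r_ann_def by blast
      then show ?thesis using a yc Lc[of "Suc k"] h_zeroD[of "a \<otimes> y"] by auto
    qed
    then show "a \<in> l_ann R Y" unfolding l_ann_def using a Lc by blast
  qed
  then show False using L(2)[of k] Y by blast
qed

text \<open>The tails T m, sums of the L k with k \<ge> m, extend to a descending chain of left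
  ideals of Q. If it stabilizes at m, a nonzero b in L m has a multiple s b, with s in D, in the sum
  of the later L k, which independence forbids.\<close>

lemma no_independent_left_ideals:
  "\<not> (\<exists>L :: nat \<Rightarrow> 'a set. (\<forall>k. left_ideal (L k) R \<and> L k \<noteq> {\<zero>}) \<and> independent_seq R L)"
proof
  assume "\<exists>L :: nat \<Rightarrow> 'a set. (\<forall>k. left_ideal (L k) R \<and> L k \<noteq> {\<zero>}) \<and> independent_seq R L"
  then obtain L :: "nat \<Rightarrow> 'a set" where
    L: "\<And>k. left_ideal (L k) R" "\<And>k. L k \<noteq> {\<zero>}" and ind: "independent_seq R L" by blast
  note Ld = nR.left_idealD[OF L(1)]
  have Lc: "x \<in> carrier R" if "x \<in> L k" for x k using that Ld(1) by blast
  \<comment> \<open>\<open>A m\<close> holds the families of summands that vanish before index m;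
    \<open>T m\<close> below consists of the sums of their initial segments.\<close>
  define A where "A m = {a. (\<forall>k. a k \<in> L k) \<and> (\<forall>k<m. a k = \<zero>)}" for m
  have Ac: "a \<in> K \<rightarrow> carrier R" if "a \<in> A m" for a m and K :: "nat set"
    using that Lc unfolding A_def by blast
  define T where "T m = {finsum R a {..<N} | a N. a \<in> A m}" for m
  \<comment> \<open>Two such sums may have different lengths; cutting a family off at N and
    continuing with zeros allows a common range.\<close>
  have pad: "\<exists>a\<in>A m. x = finsum R a {..<N'} \<and> (\<forall>k\<ge>N. a k = \<zero>)"
    if "a \<in> A m" "x = finsum R a {..<N}" "N \<le> N'" for x a m N N'
  proof -
    define a' where "a' k = (if k < N then a k else \<zero>)" for k
    have a': "a' \<in> A m" using that(1) Ld(2) unfolding A_def a'_def by auto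
    have "finsum R a {..<N} = finsum R a' {..<N}"
      by (rule R.finsum_cong') (use Ac[OF a'] in \<open>auto simp: a'_def\<close>)
    also have "\<dots> = finsum R a' {..<N'}"
      by (rule R.add.finprod_mono_neutral_cong_left) (use that Ac[OF a'] in \<open>auto simp: a'_def\<close>)
    finally show ?thesis using a' that by (intro bexI[of _ a']) (auto simp: a'_def)
  qed
  have pad': "\<exists>N. \<forall>N'\<ge>N. \<exists>a\<in>A m. x = finsum R a {..<N'}" if "x \<in> T m" for x m
    using that pad unfolding T_def by blast
  have lT: "left_ideal (T m) R" for m
  proof (rule nR.left_idealI)
    show "T m \<subseteq> carrier R" unfolding T_def using Ac by (auto intro: R.finsum_closed)
    have "(\<lambda>_. \<zero>) \<in> A m" using Ld(2) unfolding A_def by auto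
    then show "\<zero> \<in> T m" unfolding T_def by (force intro: exI[of _ 0])
    fix x y assume "x \<in> T m" "y \<in> T m"
    then obtain N1 N2 where "\<forall>N'\<ge>N1. \<exists>a\<in>A m. x = finsum R a {..<N'}"
      "\<forall>N'\<ge>N2. \<exists>a\<in>A m. y = finsum R a {..<N'}" using pad' by metis
    then obtain a b where ab: "a \<in> A m" "b \<in> A m" "x = finsum R a {..<max N1 N2}"
      "y = finsum R b {..<max N1 N2}" by (metis max.cobounded1 max.cobounded2)
    have "x \<oplus> y = finsum R (\<lambda>k. a k \<oplus> b k) {..<max N1 N2}"
      unfolding ab(3,4) by (rule R.finsum_addf[symmetric]) (use Ac ab in blast)+
    moreover have "(\<lambda>k. a k \<oplus> b k) \<in> A m" using ab Ld(3) unfolding A_def by auto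
    ultimately show "x \<oplus> y \<in> T m" unfolding T_def by blast
  next
    fix r x assume r: "r \<in> carrier R" and "x \<in> T m"
    then obtain a N where a: "a \<in> A m" "x = finsum R a {..<N}" unfolding T_def by blast
    have "r \<otimes> x = finsum R (\<lambda>k. r \<otimes> a k) {..<N}"
      unfolding a(2) by (rule R.finsum_rdistr) (use Ac a r in auto)
    moreover have "(\<lambda>k. r \<otimes> a k) \<in> A m" using a r Ld(4) unfolding A_def by auto
    ultimately show "r \<otimes> x \<in> T m" unfolding T_def by blast
  qed
  have anti: "ext (T (Suc m)) \<subseteq> ext (T m)" for m
  proof -
    have "A (Suc m) \<subseteq> A m" unfolding A_def by auto
    then have "T (Suc m) \<subseteq> T m" unfolding T_def by blast
    then show ?thesis unfolding ext_def by blast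
  qed
  obtain m where m: "ext (T (Suc m)) = ext (T m)"
    using nQ.left_artinian_stable[OF left_artinian_Q, of "\<lambda>m. ext (T m)"] left_ideal_ext[OF lT] anti
    by blast
  obtain b where b: "b \<in> L m" "b \<noteq> \<zero>" using L(2)[of m] Ld(2)[of m] by blast
  \<comment> \<open>The family with b at position m and zeros elsewhere shows that b lies in the
    tail T m.\<close>
  define f where "f = (\<lambda>k. if m = k then b else \<zero>)"
  have "f \<in> A m" unfolding f_def A_def using b Ld(2) by auto
  moreover have "b = finsum R f {..<Suc m}" unfolding f_def
    using R.finsum_singleton[of m "{..<Suc m}" "\<lambda>_. b"] Lc[OF b(1)] by auto
  ultimately have "b \<in> T m" unfolding T_def by blast
  then have "h b \<in> ext (T (Suc m))" using ext_superset[OF nR.left_idealD(1)[OF lT]] m by blast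
  then obtain s x where s: "s \<in> D" "x \<in> T (Suc m)" "h s \<otimes>\<^bsub>Q\<^esub> h b = h x"
    unfolding ext_def by blast
  have bc: "b \<in> carrier R" and xc: "x \<in> carrier R" using Lc[OF b(1)] s(2) nR.left_idealD(1)[OF lT] by blast+
  have "h (s \<otimes> b) = h x" using s bc by simp
  then have x: "x = s \<otimes> b" using inj_onD[OF inj] s(1) bc xc by simp
  obtain N where "\<forall>N'\<ge>N. \<exists>a\<in>A (Suc m). x = finsum R a {..<N'}" using pad'[OF s(2)] by blast
  then obtain a N' where a: "a \<in> A (Suc m)" "x = finsum R a {..<N'}" "N' > m"
    by (metis lessI max.cobounded1 max.strict_coboundedI2)
  \<comment> \<open>Entry m of a is free because a vanishes up to index m. Putting the negative of s
    b there makes the sum zero, so independence yields s b = 0 and hence b = 0.\<close>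
  define a' where "a' = a(m := \<ominus> (s \<otimes> b))"
  have sb: "\<ominus> (s \<otimes> b) \<in> L m" using Ld(4,5) s(1) b(1) by simp
  have a'L: "\<forall>k. a' k \<in> L k" using a(1) sb unfolding A_def a'_def by auto
  have split: "{..<N'} = insert m ({..<N'} - {m})" using a(3) by auto
  have a'c: "a' \<in> K \<rightarrow> carrier R" for K using a'L Lc by blast
  have "finsum R a' ({..<N'} - {m}) = finsum R a ({..<N'} - {m})"
    by (rule R.finsum_cong') (use Ac[OF a(1)] in \<open>auto simp: a'_def\<close>)
  also have "\<dots> = finsum R a {..<N'}"
    by (rule R.add.finprod_mono_neutral_cong_left) (use a Ac[OF a(1)] in \<open>auto simp: A_def\<close>)
  finally have "finsum R a' ({..<N'} - {m}) = s \<otimes> b" using a(2) x by simp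
  then have "finsum R a' {..<N'} = \<ominus> (s \<otimes> b) \<oplus> (s \<otimes> b)"
    by (subst split, subst R.finsum_insert) (use a'c sb Lc in \<open>auto simp: a'_def\<close>)
  then have "finsum R a' {..<N'} = \<zero>" using s(1) bc by (simp add: R.l_neg)
  then have "a' m = \<zero>" using ind a'L a(3) unfolding independent_seq_def by blast
  then have "s \<otimes> b = \<zero>" using s(1) bc by (simp add: a'_def)
  then have "h s \<otimes>\<^bsub>Q\<^esub> h b = \<zero>\<^bsub>Q\<^esub>" using s bc x by simp
  then have "h b = \<zero>\<^bsub>Q\<^esub>" using Units_cancel_zero[OF D_Units[OF s(1)]] bc by simp
  then show False using h_zeroD bc b by blast
qed

lemma left_goldie: "left_goldie R"
  unfolding left_goldie_def
  using R.ring_axioms no_ascending_left_annihilators no_independent_left_ideals by blast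

end

section \<open>Products of simple Artinian rings of fractions\<close>

lemma carrier_FactRing: "carrier (R Quot I) = (\<lambda>x. I +>\<^bsub>R\<^esub> x) ` carrier R"
  by (auto simp: FactRing_def A_RCOSETS_def RCOSETS_def a_r_coset_def)

section \<open>Passage to the quotient by the kernel\<close>

context simple_left_fractions
begin

abbreviation (input) ker :: "'a set" where "ker \<equiv> a_kernel R Q h"

text \<open>The map on R/ker induced by h: on each coset h is constant, so its image is a
  singleton.\<close>

definition quot_map :: "'a set \<Rightarrow> 'b" where
  "quot_map U = the_elem (h ` U)"

lemma quot_map_coset [simp]: "r \<in> carrier R \<Longrightarrow> quot_map (ker +> r) = h r"
  unfolding quot_map_def by (rule the_elem_simp)

lemma injective_quot_map: "injective_left_fractions (R Quot ker) Q quot_map ((+>) ker ` D)"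
proof -
  interpret I: ideal ker R by (rule kernel_is_ideal)
  have carr: "carrier (R Quot ker) = (+>) ker ` carrier R"
    by (rule carrier_FactRing)
  have hom: "quot_map \<in> ring_hom (R Quot ker) Q"
    unfolding quot_map_def by (rule the_elem_hom)
  interpret q: ring_hom_ring "R Quot ker" Q quot_map
    by (intro ring_hom_ringI2 I.quotient_is_ring S.ring_axioms hom)
  show ?thesis
  proof (unfold_locales)
    show "(+>) ker ` D \<subseteq> carrier (R Quot ker)" unfolding carr using D_subset by blast
    show "\<one>\<^bsub>R Quot ker\<^esub> \<in> (+>) ker ` D" using one_D by (auto simp: FactRing_def)
    show "U \<otimes>\<^bsub>R Quot ker\<^esub> V \<in> (+>) ker ` D" if "U \<in> (+>) ker ` D" "V \<in> (+>) ker ` D" for U V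
      using that mult_D by (auto simp: FactRing_def I.rcoset_mult_add)
    show "quot_map U \<in> Units Q" if "U \<in> (+>) ker ` D" for U
      using that D_Units by auto
    show "\<exists>U\<in>(+>) ker ` D. \<exists>V\<in>carrier (R Quot ker). quot_map U \<otimes>\<^bsub>Q\<^esub> q = quot_map V"
      if "q \<in> carrier Q" for q
      using frac[OF that] by (force simp: carr)
    show "simple_artinian Q" by (rule simple_artinian)
    show "inj_on quot_map (carrier (R Quot ker))"
      unfolding quot_map_def by (rule inj_onI) (rule the_elem_inj)
  qed
qed

lemma C_of_kernel_Units:
  assumes "c \<in> C_of R ker"
  shows "h c \<in> Units Q"
proof -
  interpret q: injective_left_fractions "R Quot ker" Q quot_map "(+>) ker ` D"
    by (rule injective_quot_map)
  show ?thesis using q.regular_Units[of "ker +> c"] assms by (auto simp: C_of_def)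
qed

lemma Units_C_of_kernel:
  assumes "c \<in> carrier R" "h c \<in> Units Q"
  shows "c \<in> C_of R ker"
proof -
  interpret q: injective_left_fractions "R Quot ker" Q quot_map "(+>) ker ` D"
    by (rule injective_quot_map)
  have "ker +> c \<in> carrier (R Quot ker)" using assms(1) by (simp add: carrier_FactRing)
  then show ?thesis using q.Units_regular[of "ker +> c"] assms by (simp add: C_of_def)
qed

lemma D_subset_C_of: "D \<subseteq> C_of R ker"
  using Units_C_of_kernel D_Units by auto

end

lemma
  assumes "\<And>i. i < n \<Longrightarrow> ring (Q i)"
  shows ring_prod_ring: "ring (prod_ring n Q)"
    and Units_prod_ring: "\<And>f. f \<in> carrier (prod_ring n Q) \<Longrightarrow> (\<And>i. i < n \<Longrightarrow> f i \<in> Units (Q i))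
      \<Longrightarrow> f \<in> Units (prod_ring n Q)"
proof -
  note [simp] = prod_ring_def
  note m = ring.is_monoid[OF assms] and a = ring.is_abelian_group[OF assms]
  show "ring (prod_ring n Q)"
  proof (rule ringI)
    show "abelian_group (prod_ring n Q)"
    proof (rule abelian_groupI)
      fix f assume f: "f \<in> carrier (prod_ring n Q)"
      then show "\<exists>g\<in>carrier (prod_ring n Q). g \<oplus>\<^bsub>prod_ring n Q\<^esub> f = \<zero>\<^bsub>prod_ring n Q\<^esub>"
        using a by (intro bexI[of _ "\<lambda>i\<in>{..<n}. \<ominus>\<^bsub>Q i\<^esub> f i"])
          (auto simp: PiE_iff abelian_group.l_neg abelian_group.a_inv_closed intro!: restrict_ext)
    qed (use assms in \<open>auto simp: PiE_iff extensional_def ring.ring_simprules intro!: restrict_ext PiE_ext\<close>)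
    show "Group.monoid (prod_ring n Q)"
      by (rule monoidI)
        (use m in \<open>auto simp: PiE_iff extensional_def monoid.m_assoc monoid.m_closed
          monoid.l_one monoid.r_one monoid.one_closed intro!: restrict_ext\<close>)
  qed (use assms in \<open>auto simp: PiE_iff ring.ring_simprules intro!: restrict_ext\<close>)
  fix f assume f: "f \<in> carrier (prod_ring n Q)" "\<And>i. i < n \<Longrightarrow> f i \<in> Units (Q i)"
  have "f \<in> carrier (prod_ring n Q) \<and> (\<lambda>i\<in>{..<n}. inv\<^bsub>Q i\<^esub> f i) \<in> carrier (prod_ring n Q)
    \<and> (\<lambda>i\<in>{..<n}. inv\<^bsub>Q i\<^esub> f i) \<otimes>\<^bsub>prod_ring n Q\<^esub> f = \<one>\<^bsub>prod_ring n Q\<^esub>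
    \<and> f \<otimes>\<^bsub>prod_ring n Q\<^esub> (\<lambda>i\<in>{..<n}. inv\<^bsub>Q i\<^esub> f i) = \<one>\<^bsub>prod_ring n Q\<^esub>"
    using f m by (auto simp: PiE_iff monoid.Units_inv_closed monoid.Units_l_inv monoid.Units_r_inv
        intro!: restrict_ext)
  then show "f \<in> Units (prod_ring n Q)" unfolding Units_def by blast
qed

text \<open>The conditions on the kernels are stated through elements instead of intersections of
  ideals, so that they carry over to opposite rings verbatim.\<close>

locale fraction_family = nc_ring R
  for R :: "'a ring" (structure) +
  fixes n :: nat and Q :: "nat \<Rightarrow> 'b ring" and h :: "nat \<Rightarrow> 'a \<Rightarrow> 'b" and D :: "nat \<Rightarrow> 'a set"
  assumes fractions: "\<And>i. i < n \<Longrightarrow> simple_left_fractions R (Q i) (h i) (D i)"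
    and faithful: "\<And>r. r \<in> carrier R \<Longrightarrow> (\<And>i. i < n \<Longrightarrow> h i r = \<zero>\<^bsub>Q i\<^esub>) \<Longrightarrow> r = \<zero>"
    and irredundant: "\<And>i. i < n \<Longrightarrow> \<exists>r\<in>carrier R. r \<noteq> \<zero> \<and> (\<forall>j<n. j \<noteq> i \<longrightarrow> h j r = \<zero>\<^bsub>Q j\<^esub>)"
begin

abbreviation kern :: "nat \<Rightarrow> 'a set" where "kern i \<equiv> a_kernel R (Q i) (h i)"

lemma ring_Q: "i < n \<Longrightarrow> ring (Q i)"
  using fractions unfolding simple_left_fractions_def left_fractions_def ring_hom_ring_def by blast

lemma h_simps [simp]:
  assumes "i < n"
  shows "x \<in> carrier R \<Longrightarrow> h i x \<in> carrier (Q i)"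
    "x \<in> carrier R \<Longrightarrow> y \<in> carrier R \<Longrightarrow> h i (x \<otimes> y) = h i x \<otimes>\<^bsub>Q i\<^esub> h i y"
    "x \<in> carrier R \<Longrightarrow> y \<in> carrier R \<Longrightarrow> h i (x \<oplus> y) = h i x \<oplus>\<^bsub>Q i\<^esub> h i y"
    "h i \<zero> = \<zero>\<^bsub>Q i\<^esub>" "h i \<one> = \<one>\<^bsub>Q i\<^esub>"
proof -
  interpret simple_left_fractions R "Q i" "h i" "D i" using fractions assms .
  show "x \<in> carrier R \<Longrightarrow> h i x \<in> carrier (Q i)"
    "x \<in> carrier R \<Longrightarrow> y \<in> carrier R \<Longrightarrow> h i (x \<otimes> y) = h i x \<otimes>\<^bsub>Q i\<^esub> h i y"
    "x \<in> carrier R \<Longrightarrow> y \<in> carrier R \<Longrightarrow> h i (x \<oplus> y) = h i x \<oplus>\<^bsub>Q i\<^esub> h i y"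
    "h i \<zero> = \<zero>\<^bsub>Q i\<^esub>" "h i \<one> = \<one>\<^bsub>Q i\<^esub>" by auto
qed

lemma Q_simps [simp]:
  assumes "i < n"
  shows "x \<in> carrier (Q i) \<Longrightarrow> x \<otimes>\<^bsub>Q i\<^esub> \<zero>\<^bsub>Q i\<^esub> = \<zero>\<^bsub>Q i\<^esub>"
    "x \<in> carrier (Q i) \<Longrightarrow> \<zero>\<^bsub>Q i\<^esub> \<otimes>\<^bsub>Q i\<^esub> x = \<zero>\<^bsub>Q i\<^esub>"
    "x \<in> carrier (Q i) \<Longrightarrow> x \<oplus>\<^bsub>Q i\<^esub> \<zero>\<^bsub>Q i\<^esub> = x"
    "x \<in> carrier (Q i) \<Longrightarrow> \<zero>\<^bsub>Q i\<^esub> \<oplus>\<^bsub>Q i\<^esub> x = x" "\<zero>\<^bsub>Q i\<^esub> \<in> carrier (Q i)"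
  using ring_Q[OF assms] by (simp_all add: ring.ring_simprules)

lemma ideal_joint_kernel:
  assumes "K \<subseteq> {..<n}"
  shows "ideal {x \<in> carrier R. \<forall>j\<in>K. h j x = \<zero>\<^bsub>Q j\<^esub>} R"
  unfolding ideal_iff_left_right using assms
  by (intro conjI left_idealI right_idealI) (auto simp: subset_iff)

text \<open>The joint kernel of all the maps is zero and so lies in P. Removing one map at a time,
  primeness either produces its kernel inside P or keeps the joint kernel of the remaining maps
  inside P.\<close>

lemma prime_contains_kernel:
  assumes P: "nc_prime R P"
  shows "\<exists>i<n. kern i \<subseteq> P"
proof -
  have "\<exists>i<m. kern i \<subseteq> P" if "m \<le> n" "{x \<in> carrier R. \<forall>j\<in>{..<m}. h j x = \<zero>\<^bsub>Q j\<^esub>} \<subseteq> P" for m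
    using that
  proof (induction m)
    \<comment> \<open>The joint kernel of no maps is all of R, which a prime ideal cannot
      contain.\<close>
    case 0
    have "P \<subseteq> carrier R" using P left_idealD(1) unfolding nc_prime_def ideal_iff_left_right by blast
    then show ?case using 0 P unfolding nc_prime_def by auto
  next
    case (Suc m)
    let ?I = "{x \<in> carrier R. \<forall>j\<in>{..<m}. h j x = \<zero>\<^bsub>Q j\<^esub>}"
    let ?J = "{x \<in> carrier R. \<forall>j\<in>{m}. h j x = \<zero>\<^bsub>Q j\<^esub>}"
    have m: "m < n" using Suc.prems by simp
    have "ideal ?I R" by (rule ideal_joint_kernel) (use m in auto)
    moreover have "ideal ?J R" by (rule ideal_joint_kernel) (use m in auto)
    moreover have "a \<otimes> b \<in> P" if "a \<in> ?I" "b \<in> ?J" for a b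
      using that m by (intro subsetD[OF Suc.prems(2)]) (auto simp: less_Suc_eq)
    ultimately have "?I \<subseteq> P \<or> ?J \<subseteq> P" using P unfolding nc_prime_def by blast
    moreover have "?J = kern m" by (simp add: a_kernel_def')
    ultimately consider "?I \<subseteq> P" | "kern m \<subseteq> P" by auto
    then show ?case
    proof cases
      case 1
      then have "\<exists>i<m. kern i \<subseteq> P" using Suc.IH m by simp
      then show ?thesis using less_SucI by blast
    qed blast
  qed
  from this[of n] show ?thesis
  proof -
    have "\<zero> \<in> P" using P left_idealD(2) unfolding nc_prime_def ideal_iff_left_right by blast
    then have "{x \<in> carrier R. \<forall>j\<in>{..<n}. h j x = \<zero>\<^bsub>Q j\<^esub>} \<subseteq> P" using faithful by auto
    then show ?thesis using \<open>\<lbrakk>n \<le> n; _\<rbrakk> \<Longrightarrow> _\<close> by blast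
  qed
qed

text \<open>The irredundance witness for i lies in every other kernel. If one of these were inside
  \<open>kern i\<close>, the witness would lie in all kernels and be zero.\<close>

lemma ker_incomparable:
  assumes "i < n" "j < n" "kern j \<subseteq> kern i"
  shows "j = i"
proof (rule ccontr)
  assume "j \<noteq> i"
  obtain r where r: "r \<in> carrier R" "r \<noteq> \<zero>" "\<forall>k<n. k \<noteq> i \<longrightarrow> h k r = \<zero>\<^bsub>Q k\<^esub>"
    using irredundant assms(1) by blast
  then have "r \<in> kern i" using assms(2,3) \<open>j \<noteq> i\<close> by (auto simp: a_kernel_def')
  then have "h k r = \<zero>\<^bsub>Q k\<^esub>" if "k < n" for k
    using r(3) that by (cases "k = i") (auto simp: a_kernel_def')
  then show False using faithful r by blast
qed

lemma min_primes_eq: "min_primes R = kern ` {..<n}"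
proof -
  have prime: "nc_prime R (kern i)" if "i < n" for i
    using simple_left_fractions.prime_kernel[OF fractions[OF that]] .
  show ?thesis
  proof (intro equalityI subsetI)
    fix P assume "P \<in> min_primes R"
    then have P: "nc_prime R P" "\<And>P'. nc_prime R P' \<Longrightarrow> \<not> P' \<subset> P" by (auto simp: min_primes_def)
    obtain i where "i < n" "kern i \<subseteq> P" using prime_contains_kernel[OF P(1)] by blast
    then show "P \<in> kern ` {..<n}" using P(2)[OF prime] by blast
  next
    fix P assume "P \<in> kern ` {..<n}"
    then obtain i where i: "i < n" "P = kern i" by blast
    have "\<not> P' \<subset> kern i" if P': "nc_prime R P'" for P'
    proof
      assume *: "P' \<subset> kern i"
      obtain j where j: "j < n" "kern j \<subseteq> P'" using prime_contains_kernel[OF P'] by blast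
      then have "j = i" using ker_incomparable i(1) * by blast
      then show False using j * by blast
    qed
    then show "P \<in> min_primes R" using prime i by (auto simp: min_primes_def)
  qed
qed

text \<open>The irredundance witness shows that the intersection of the other kernels is an ideal
  not inside \<open>kern i\<close>, so it contains an element with the same image in
  \<open>Q i\<close> as a denominator.\<close>

lemma separating_element:
  assumes "i < n"
  shows "\<exists>u\<in>carrier R. h i u \<in> Units (Q i) \<and> (\<forall>j<n. j \<noteq> i \<longrightarrow> h j u = \<zero>\<^bsub>Q j\<^esub>)"
proof -
  interpret F: simple_left_fractions R "Q i" "h i" "D i" using fractions assms .
  let ?J = "{x \<in> carrier R. \<forall>j\<in>{..<n} - {i}. h j x = \<zero>\<^bsub>Q j\<^esub>}"
  obtain r where r: "r \<in> carrier R" "r \<noteq> \<zero>" "\<forall>k<n. k \<noteq> i \<longrightarrow> h k r = \<zero>\<^bsub>Q k\<^esub>"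
    using irredundant assms by blast
  have "h i r \<noteq> \<zero>\<^bsub>Q i\<^esub>" using faithful r by metis
  moreover have "ideal ?J R" by (rule ideal_joint_kernel) auto
  moreover have "r \<in> ?J" using r by auto
  ultimately obtain s c where "s \<in> D i" "c \<in> ?J" "h i c = h i s" using F.ideal_meets_D by blast
  then show ?thesis using F.D_Units by (intro bexI[of _ c]) auto
qed

text \<open>One \<open>h i\<close> need not be injective, so r c in \<open>kern i\<close> gives
  nothing directly. Multiplying by the separating element u makes u r c vanish in every factor; then
  u r c = 0, regularity gives u r = 0, and h i u is a unit.\<close>

lemma regular_Units:
  assumes "c \<in> regular R" "i < n"
  shows "h i c \<in> Units (Q i)"
proof -
  interpret F: simple_left_fractions R "Q i" "h i" "D i" using fractions assms(2) .
  obtain u where u: "u \<in> carrier R" "h i u \<in> Units (Q i)" "\<forall>j<n. j \<noteq> i \<longrightarrow> h j u = \<zero>\<^bsub>Q j\<^esub>"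
    using separating_element assms(2) by blast
  have c: "c \<in> carrier R" using assms(1) by (simp add: regular_def)
  show ?thesis
  proof (rule F.h_Units[OF c])
    fix r assume r: "r \<in> carrier R" "h i (r \<otimes> c) = \<zero>\<^bsub>Q i\<^esub>"
    have "h j (u \<otimes> (r \<otimes> c)) = \<zero>\<^bsub>Q j\<^esub>" if "j < n" for j
    proof (cases "j = i")
      case True
      have "h i (u \<otimes> (r \<otimes> c)) = h i u \<otimes>\<^bsub>Q i\<^esub> h i (r \<otimes> c)" using u r(1) c by (intro h_simps(2) assms) auto
      then show ?thesis using True u r assms(2) by simp
    next
      case False
      have "h j (u \<otimes> (r \<otimes> c)) = h j u \<otimes>\<^bsub>Q j\<^esub> h j (r \<otimes> c)" using u r(1) c that by (intro h_simps(2)) auto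
      then show ?thesis using False u r(1) c that by (simp del: h_simps(2))
    qed
    then have "u \<otimes> (r \<otimes> c) = \<zero>"
      by (rule faithful[rotated]) (use u(1) r(1) c in auto)
    then have "u \<otimes> r \<otimes> c = \<zero>" using u r(1) c by (simp add: m_assoc)
    then have "u \<otimes> r = \<zero>" using assms(1) u(1) r(1) unfolding regular_def by blast
    then have "h i u \<otimes>\<^bsub>Q i\<^esub> h i r = \<zero>\<^bsub>Q i\<^esub>" using u r assms(2) h_simps by metis
    then show "h i r = \<zero>\<^bsub>Q i\<^esub>" using F.Units_cancel_zero[OF u(2)] r(1) by simp
  qed
qed

lemma Units_regular:
  assumes "c \<in> carrier R" "\<And>i. i < n \<Longrightarrow> h i c \<in> Units (Q i)"
  shows "c \<in> regular R"
  unfolding regular_def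
proof (intro CollectI conjI ballI impI assms(1))
  fix x assume x: "x \<in> carrier R"
  show "x = \<zero>" if "c \<otimes> x = \<zero>"
  proof (rule faithful[OF x])
    fix i assume i: "i < n"
    interpret F: simple_left_fractions R "Q i" "h i" "D i" using fractions i .
    have "h i c \<otimes>\<^bsub>Q i\<^esub> h i x = \<zero>\<^bsub>Q i\<^esub>" using that x assms(1) i h_simps by metis
    then show "h i x = \<zero>\<^bsub>Q i\<^esub>" using F.Units_cancel_zero[OF assms(2)[OF i]] x by simp
  qed
  show "x = \<zero>" if "x \<otimes> c = \<zero>"
  proof (rule faithful[OF x])
    fix i assume i: "i < n"
    interpret F: simple_left_fractions R "Q i" "h i" "D i" using fractions i .
    have "h i x \<otimes>\<^bsub>Q i\<^esub> h i c \<otimes>\<^bsub>Q i\<^esub> inv\<^bsub>Q i\<^esub> (h i c) = \<zero>\<^bsub>Q i\<^esub>"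
      using that x assms(1) assms(2)[OF i] i h_simps F.S.Units_inv_closed F.S.l_null by metis
    then show "h i x = \<zero>\<^bsub>Q i\<^esub>" using x assms(1) assms(2)[OF i] by (simp add: F.S.m_assoc)
  qed
qed

text \<open>The sum of the v i works, since only v j contributes to coordinate j; the induction runs
  through its partial sums.\<close>

lemma patch:
  assumes "\<And>i. i < n \<Longrightarrow> v i \<in> carrier R"
    and "\<And>i j. i < n \<Longrightarrow> j < n \<Longrightarrow> j \<noteq> i \<Longrightarrow> h j (v i) = \<zero>\<^bsub>Q j\<^esub>"
  shows "\<exists>x\<in>carrier R. \<forall>j<n. h j x = h j (v j)"
proof -
  have "\<exists>x\<in>carrier R. \<forall>j<n. h j x = (if j < m then h j (v j) else \<zero>\<^bsub>Q j\<^esub>)" if "m \<le> n" for m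
    using that
  proof (induction m)
    case 0
    then show ?case by (intro bexI[of _ \<zero>]) auto
  next
    case (Suc m)
    then obtain x where "x \<in> carrier R" "\<forall>j<n. h j x = (if j < m then h j (v j) else \<zero>\<^bsub>Q j\<^esub>)"
      by auto
    then show ?case
      using Suc.prems assms by (intro bexI[of _ "x \<oplus> v m"]) (auto simp: less_Suc_eq)
  qed
  from this[of n] show ?thesis by auto
qed

definition prod_map :: "'a \<Rightarrow> nat \<Rightarrow> 'b" where
  "prod_map r = (\<lambda>i\<in>{..<n}. h i r)"

text \<open>Each coordinate of q has its own fraction, with denominator s i and numerator r i.
  Multiplying both by the separating u i and summing over i gives a single denominator c, a unit in
  every coordinate, and a single numerator d.\<close>

lemma is_lcq_prod: "is_lcq R (prod_ring n Q) prod_map"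
  unfolding is_lcq_def
proof (intro conjI ballI)
  show rP: "ring (prod_ring n Q)" by (rule ring_prod_ring) (rule ring_Q)
  interpret P: ring "prod_ring n Q" by (rule rP)
  show hP: "prod_map \<in> ring_hom R (prod_ring n Q)"
    by (rule ring_hom_memI) (auto simp: prod_map_def prod_ring_def intro!: restrict_ext)
  show "inj_on prod_map (carrier R)"
  proof (rule inj_onI)
    fix x y assume x: "x \<in> carrier R" "y \<in> carrier R" "prod_map x = prod_map y"
    have "x \<ominus> y = \<zero>"
    proof (rule faithful)
      show "x \<ominus> y \<in> carrier R" using x by simp
      fix i assume i: "i < n"
      interpret F: simple_left_fractions R "Q i" "h i" "D i" using fractions i .
      have "h i x = h i y" using x(3) i unfolding prod_map_def by (metis lessThan_iff restrict_apply')
      then show "h i (x \<ominus> y) = \<zero>\<^bsub>Q i\<^esub>" using x by (simp add: a_minus_def F.S.r_neg del: F.S.r_right_minus_eq)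
    qed
    then show "x = y" using x by simp
  qed
  have UP: "prod_map c \<in> Units (prod_ring n Q)"
    if "c \<in> carrier R" "\<And>i. i < n \<Longrightarrow> h i c \<in> Units (Q i)" for c
    using that ring_hom_closed[OF hP] by (intro Units_prod_ring ring_Q) (auto simp: prod_map_def)
  show "prod_map ` regular R \<subseteq> Units (prod_ring n Q)"
    using UP regular_Units by (auto simp: regular_def)
  fix q assume q: "q \<in> carrier (prod_ring n Q)"
  have qi: "q i \<in> carrier (Q i)" if "i < n" for i using q that by (auto simp: prod_ring_def)
  have "\<exists>u s r. u \<in> carrier R \<and> h i u \<in> Units (Q i) \<and> (\<forall>j<n. j \<noteq> i \<longrightarrow> h j u = \<zero>\<^bsub>Q j\<^esub>)
    \<and> s \<in> carrier R \<and> h i s \<in> Units (Q i) \<and> r \<in> carrier R \<and> h i s \<otimes>\<^bsub>Q i\<^esub> q i = h i r"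
    if i: "i < n" for i
  proof -
    interpret F: simple_left_fractions R "Q i" "h i" "D i" using fractions i .
    show ?thesis using separating_element[OF i] F.frac[OF qi[OF i]] F.D_Units F.D_carrier by blast
  qed
  then obtain u s r where *: "\<And>i. i < n \<Longrightarrow> u i \<in> carrier R \<and> h i (u i) \<in> Units (Q i)
    \<and> (\<forall>j<n. j \<noteq> i \<longrightarrow> h j (u i) = \<zero>\<^bsub>Q j\<^esub>) \<and> s i \<in> carrier R \<and> h i (s i) \<in> Units (Q i)
    \<and> r i \<in> carrier R \<and> h i (s i) \<otimes>\<^bsub>Q i\<^esub> q i = h i (r i)"
    by metis
  obtain c where c: "c \<in> carrier R" "\<And>j. j < n \<Longrightarrow> h j c = h j (u j \<otimes> s j)"
    using patch[of "\<lambda>i. u i \<otimes> s i"] * by auto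
  obtain d where d: "d \<in> carrier R" "\<And>j. j < n \<Longrightarrow> h j d = h j (u j \<otimes> r j)"
    using patch[of "\<lambda>i. u i \<otimes> r i"] * by auto
  have cU: "h i c \<in> Units (Q i)" if "i < n" for i
  proof -
    interpret Q: ring "Q i" using ring_Q that .
    show ?thesis using *[OF that] c(2)[OF that] that by simp
  qed
  have "h i c \<otimes>\<^bsub>Q i\<^esub> q i = h i d" if "i < n" for i
  proof -
    interpret Q: ring "Q i" using ring_Q that .
    show ?thesis using *[OF that] c(2)[OF that] d(2)[OF that] qi[OF that] that by (simp add: Q.m_assoc)
  qed
  then have "prod_map c \<otimes>\<^bsub>prod_ring n Q\<^esub> q = prod_map d"
    by (auto simp: prod_map_def prod_ring_def intro!: restrict_ext)
  then have "q = inv\<^bsub>prod_ring n Q\<^esub> (prod_map c) \<otimes>\<^bsub>prod_ring n Q\<^esub> prod_map d"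
    using UP[OF c(1) cU] q by (metis P.m_assoc P.Units_l_inv P.l_one P.Units_closed P.Units_inv_closed)
  then show "\<exists>c\<in>regular R. \<exists>a\<in>carrier R.
      q = inv\<^bsub>prod_ring n Q\<^esub> (prod_map c) \<otimes>\<^bsub>prod_ring n Q\<^esub> prod_map a"
    using Units_regular[OF c(1) cU] d(1) by blast
qed

end

section \<open>Localization by inverting a set of elements\<close>

lemma free_ring_carrier:
  "f \<in> carrier (free_ring V) \<longleftrightarrow> finite {w. f w \<noteq> 0} \<and> (\<forall>w. f w \<noteq> 0 \<longrightarrow> set w \<subseteq> V)"
  by (simp add: free_ring_def)

lemma free_ring_simps [simp]:
  "\<one>\<^bsub>free_ring V\<^esub> = (\<lambda>w. if w = [] then 1 else 0)"
  "\<zero>\<^bsub>free_ring V\<^esub> = (\<lambda>w. 0)"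
  "f \<oplus>\<^bsub>free_ring V\<^esub> g = (\<lambda>w. f w + g w)"
  by (simp_all add: free_ring_def)

lemma free_ring_mult:
  "f \<otimes>\<^bsub>free_ring V\<^esub> g = (\<lambda>w. \<Sum>i\<le>length w. f (take i w) * g (drop i w))"
  by (simp add: free_ring_def)

lemma free_ring_mult_nonzero:
  assumes "(f \<otimes>\<^bsub>free_ring V\<^esub> g) w \<noteq> 0"
  shows "\<exists>i. f (take i w) \<noteq> 0 \<and> g (drop i w) \<noteq> 0"
proof (rule ccontr)
  assume "\<nexists>i. f (take i w) \<noteq> 0 \<and> g (drop i w) \<noteq> 0"
  then have "\<forall>i\<in>{..length w}. f (take i w) * g (drop i w) = 0" by auto
  then have "(\<Sum>i\<le>length w. f (take i w) * g (drop i w)) = 0" by (intro sum.neutral) blast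
  then show False using assms by (simp add: free_ring_mult)
qed

lemma free_ring_mult_closed:
  assumes "f \<in> carrier (free_ring V)" "g \<in> carrier (free_ring V)"
  shows "f \<otimes>\<^bsub>free_ring V\<^esub> g \<in> carrier (free_ring V)"
proof -
  let ?p = "f \<otimes>\<^bsub>free_ring V\<^esub> g"
  have "{w. ?p w \<noteq> 0} \<subseteq> (\<lambda>(u, v). u @ v) ` ({w. f w \<noteq> 0} \<times> {w. g w \<noteq> 0})"
  proof
    fix w assume "w \<in> {w. ?p w \<noteq> 0}"
    then obtain i where "f (take i w) \<noteq> 0" "g (drop i w) \<noteq> 0"
      using free_ring_mult_nonzero by blast
    then show "w \<in> (\<lambda>(u, v). u @ v) ` ({w. f w \<noteq> 0} \<times> {w. g w \<noteq> 0})"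
      by (intro image_eqI[of _ _ "(take i w, drop i w)"]) auto
  qed
  then have "finite {w. ?p w \<noteq> 0}"
    by (rule finite_subset) (use assms in \<open>auto simp: free_ring_carrier\<close>)
  moreover have "set w \<subseteq> V" if w: "?p w \<noteq> 0" for w
  proof -
    obtain i where "f (take i w) \<noteq> 0" "g (drop i w) \<noteq> 0"
      using free_ring_mult_nonzero w by blast
    then have "set (take i w) \<subseteq> V" "set (drop i w) \<subseteq> V"
      using assms by (auto simp: free_ring_carrier)
    then have "set (take i w @ drop i w) \<subseteq> V" by (simp only: set_append Un_subset_iff)
    then show ?thesis by simp
  qed
  ultimately show ?thesis by (simp add: free_ring_carrier)
qed

text \<open>Both sides sum over the ways to cut w into three pieces; \<open>F i j\<close> is the
  term whose first two pieces have lengths i and j.\<close>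

lemma free_ring_mult_assoc:
  "(f \<otimes>\<^bsub>free_ring V\<^esub> g) \<otimes>\<^bsub>free_ring V\<^esub> k = f \<otimes>\<^bsub>free_ring V\<^esub> (g \<otimes>\<^bsub>free_ring V\<^esub> k)"
proof
  fix w :: "'a list"
  define n where "n = length w"
  define F where "F i j = f (take i w) * g (take j (drop i w)) * k (drop (i + j) w)" for i j
  have "((f \<otimes>\<^bsub>free_ring V\<^esub> g) \<otimes>\<^bsub>free_ring V\<^esub> k) w
      = (\<Sum>i\<le>n. \<Sum>j\<le>i. F j (i - j))"
    unfolding free_ring_mult n_def F_def
    by (auto simp: sum_distrib_right min_def drop_take intro!: sum.cong)
  also have "\<dots> = (\<Sum>(i,j)\<in>{(i,j). i + j \<le> n}. F i j)"
    by (rule sum.triangle_reindex_eq[symmetric])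
  also have "{(i,j). i + j \<le> n} = Sigma {..n} (\<lambda>i. {..n - i})" by auto
  also have "(\<Sum>(i,j)\<in>Sigma {..n} (\<lambda>i. {..n - i}). F i j) = (\<Sum>i\<le>n. \<Sum>j\<le>n - i. F i j)"
    by (rule sum.Sigma[symmetric]) auto
  also have "\<dots> = (f \<otimes>\<^bsub>free_ring V\<^esub> (g \<otimes>\<^bsub>free_ring V\<^esub> k)) w"
    unfolding free_ring_mult n_def F_def
    by (auto simp: sum_distrib_left mult.assoc add.commute intro!: sum.cong)
  finally show "((f \<otimes>\<^bsub>free_ring V\<^esub> g) \<otimes>\<^bsub>free_ring V\<^esub> k) w = (f \<otimes>\<^bsub>free_ring V\<^esub> (g \<otimes>\<^bsub>free_ring V\<^esub> k)) w" .
qed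

lemma free_ring_one_mult: "\<one>\<^bsub>free_ring V\<^esub> \<otimes>\<^bsub>free_ring V\<^esub> f = f"
proof
  fix w :: "'a list"
  have "(\<one>\<^bsub>free_ring V\<^esub> \<otimes>\<^bsub>free_ring V\<^esub> f) w = (\<Sum>i\<le>length w. if i = 0 then f w else 0)"
    unfolding free_ring_mult by (intro sum.cong) auto
  then show "(\<one>\<^bsub>free_ring V\<^esub> \<otimes>\<^bsub>free_ring V\<^esub> f) w = f w" by simp
qed

lemma free_ring_mult_one: "f \<otimes>\<^bsub>free_ring V\<^esub> \<one>\<^bsub>free_ring V\<^esub> = f"
proof
  fix w :: "'a list"
  have "(f \<otimes>\<^bsub>free_ring V\<^esub> \<one>\<^bsub>free_ring V\<^esub>) w = (\<Sum>i\<le>length w. if i = length w then f w else 0)"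
    unfolding free_ring_mult by (intro sum.cong) auto
  then show "(f \<otimes>\<^bsub>free_ring V\<^esub> \<one>\<^bsub>free_ring V\<^esub>) w = f w" by simp
qed

lemma free_ring_add_closed:
  "f \<in> carrier (free_ring V) \<Longrightarrow> g \<in> carrier (free_ring V) \<Longrightarrow> (\<lambda>w. f w + g w) \<in> carrier (free_ring V)"
proof -
  assume *: "f \<in> carrier (free_ring V)" "g \<in> carrier (free_ring V)"
  have "{w. f w + g w \<noteq> 0} \<subseteq> {w. f w \<noteq> 0} \<union> {w. g w \<noteq> 0}" by auto
  then have "finite {w. f w + g w \<noteq> 0}"
    by (rule finite_subset) (use * in \<open>auto simp: free_ring_carrier\<close>)
  moreover have "set w \<subseteq> V" if "f w + g w \<noteq> 0" for w
    using that * unfolding free_ring_carrier by (cases "f w = 0") auto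
  ultimately show ?thesis by (simp add: free_ring_carrier)
qed

lemma free_ring_uminus_closed:
  "f \<in> carrier (free_ring V) \<Longrightarrow> (\<lambda>w. - f w) \<in> carrier (free_ring V)"
  by (simp add: free_ring_carrier)

lemma fsub_closed:
  "f \<in> carrier (free_ring V) \<Longrightarrow> g \<in> carrier (free_ring V) \<Longrightarrow> fsub f g \<in> carrier (free_ring V)"
  using free_ring_add_closed[OF _ free_ring_uminus_closed[of g]] by (simp add: fsub_def)

lemma free_ring_one_closed: "(\<lambda>w. if w = [] then 1 else 0) \<in> carrier (free_ring V)"
  by (simp add: free_ring_carrier)

lemma ring_free_ring: "ring (free_ring V)"
proof (rule ringI)
  show "abelian_group (free_ring V)"
  proof (rule abelian_groupI)
    fix f assume "f \<in> carrier (free_ring V)"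
    then show "\<exists>g\<in>carrier (free_ring V). g \<oplus>\<^bsub>free_ring V\<^esub> f = \<zero>\<^bsub>free_ring V\<^esub>"
      by (intro bexI[OF _ free_ring_uminus_closed]) auto
  qed (auto simp: free_ring_add_closed, simp add: free_ring_carrier)
  show "Group.monoid (free_ring V)"
    by (rule monoidI)
      (simp_all add: free_ring_mult_closed free_ring_mult_assoc free_ring_one_closed
        free_ring_one_mult[simplified] free_ring_mult_one[simplified])
qed (simp_all add: free_ring_mult fun_eq_iff distrib_left distrib_right sum.distrib)

interpretation free_ring: ring "free_ring V" for V
  by (rule ring_free_ring)

lemma free_ring_a_inv:
  assumes "f \<in> carrier (free_ring V)"
  shows "\<ominus>\<^bsub>free_ring V\<^esub> f = (\<lambda>w. - f w)"
  by (rule free_ring.minus_equality) (use assms free_ring_uminus_closed in \<open>auto simp: fun_eq_iff\<close>)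

lemma fsub_eq:
  "f \<in> carrier (free_ring V) \<Longrightarrow> g \<in> carrier (free_ring V) \<Longrightarrow> fsub f g = f \<ominus>\<^bsub>free_ring V\<^esub> g"
  by (simp add: a_minus_def free_ring_a_inv fsub_def)

lemma fgen_closed: "v \<in> V \<Longrightarrow> fgen v \<in> carrier (free_ring V)"
  by (simp add: free_ring_carrier fgen_def)

lemma fgen_mult:
  "(fgen v \<otimes>\<^bsub>free_ring V\<^esub> f) w = (case w of [] \<Rightarrow> 0 | u # w' \<Rightarrow> if u = v then f w' else 0)"
proof (cases w)
  case (Cons u w')
  have "(fgen v \<otimes>\<^bsub>free_ring V\<^esub> f) w = (\<Sum>i\<le>length w. if i = 1 then (if u = v then f w' else 0) else 0)"
    unfolding free_ring_mult fgen_def Cons by (intro sum.cong) (auto simp: take_Cons' drop_Cons')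
  also have "\<dots> = (if u = v then f w' else 0)"
    by (subst sum.delta) (auto simp: Cons)
  finally show ?thesis using Cons by simp
qed (simp add: free_ring_mult fgen_def)

definition word :: "'v list \<Rightarrow> 'v list \<Rightarrow> int" where
  "word w = (\<lambda>u. if u = w then 1 else 0)"

lemma word_Cons: "word (v # w) = fgen v \<otimes>\<^bsub>free_ring V\<^esub> word w"
proof
  fix u show "word (v # w) u = (fgen v \<otimes>\<^bsub>free_ring V\<^esub> word w) u"
    unfolding fgen_mult by (cases u) (auto simp: word_def)
qed

text \<open>The variables generate the ring: words are products of variables, integer multiples of
  words are sums and negatives, and an element is rebuilt by adding one word of its support at a
  time.\<close>

lemma free_ring_induct [consumes 1, case_names one gen add minus mult]:
  assumes "f \<in> carrier (free_ring V)"
    and one: "P \<one>\<^bsub>free_ring V\<^esub>"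
    and gen: "\<And>v. v \<in> V \<Longrightarrow> P (fgen v)"
    and add: "\<And>f g. f \<in> carrier (free_ring V) \<Longrightarrow> g \<in> carrier (free_ring V) \<Longrightarrow> P f \<Longrightarrow> P g
      \<Longrightarrow> P (f \<oplus>\<^bsub>free_ring V\<^esub> g)"
    and minus: "\<And>f. f \<in> carrier (free_ring V) \<Longrightarrow> P f \<Longrightarrow> P (\<ominus>\<^bsub>free_ring V\<^esub> f)"
    and mult: "\<And>f g. f \<in> carrier (free_ring V) \<Longrightarrow> g \<in> carrier (free_ring V) \<Longrightarrow> P f \<Longrightarrow> P g
      \<Longrightarrow> P (f \<otimes>\<^bsub>free_ring V\<^esub> g)"
  shows "P f"
proof -
  define G where "G = {f \<in> carrier (free_ring V). P f}"
  have Gadd: "(\<lambda>w. f w + g w) \<in> G" if "f \<in> G" "g \<in> G" for f g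
    using that add[of f g] unfolding G_def by (simp add: free_ring_add_closed)
  have Gminus: "(\<lambda>w. - f w) \<in> G" if "f \<in> G" for f
    using that minus[of f] unfolding G_def by (simp add: free_ring_uminus_closed free_ring_a_inv)
  have G1: "\<one>\<^bsub>free_ring V\<^esub> \<in> G" using one unfolding G_def by (simp add: free_ring_one_closed)
  have G0: "(\<lambda>w. 0) \<in> G" using Gadd[OF G1 Gminus[OF G1]] by simp
  have Gword: "word w \<in> G" if "set w \<subseteq> V" for w
    using that
  proof (induction w)
    case Nil
    then show ?case using G1 by (simp add: word_def)
  next
    case (Cons v w)
    then show ?case
      using mult[of "fgen v" "word w"] gen[of v] fgen_closed[of v V]
      unfolding word_Cons[of v w V] G_def by (simp add: free_ring_mult_closed)
  qed
  have Gmul: "(\<lambda>u. c * f u) \<in> G" if "f \<in> G" for f and c :: int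
  proof (induction c rule: int_induct[of _ 0])
    case base
    then show ?case using G0 by simp
  next
    case (step1 i)
    then show ?case using Gadd[OF step1(2) that] by (simp add: algebra_simps)
  next
    case (step2 i)
    then show ?case using Gadd[OF step2(2) Gminus[OF that]] by (simp add: algebra_simps)
  qed
  have "f \<in> G" if "finite W" "{w. f w \<noteq> 0} \<subseteq> W" "\<forall>w. f w \<noteq> 0 \<longrightarrow> set w \<subseteq> V" for W f
    using that
  proof (induction W arbitrary: f rule: finite_induct)
    case empty
    then have "f = (\<lambda>w. 0)" by auto
    then show ?case using G0 by simp
  next
    case (insert w W)
    show ?case
    proof (cases "f w = 0")
      case True
      have "{w. f w \<noteq> 0} \<subseteq> W" using insert.prems(1) True by auto
      then show ?thesis using insert.IH insert.prems(2) by blast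
    next
      case False
      have "{u. (f(w := 0)) u \<noteq> 0} \<subseteq> W" using insert.prems(1) by auto
      moreover have "\<forall>u. (f(w := 0)) u \<noteq> 0 \<longrightarrow> set u \<subseteq> V" using insert.prems(2) by simp
      ultimately have "f(w := 0) \<in> G" using insert.IH by blast
      moreover have "(\<lambda>u. f w * word w u) \<in> G" using Gmul Gword insert.prems(2) False by simp
      moreover have "f = (\<lambda>u. (f(w := 0)) u + f w * word w u)" by (auto simp: word_def fun_eq_iff)
      ultimately show ?thesis using Gadd by metis
    qed
  qed
  then show ?thesis using assms(1) unfolding G_def free_ring_carrier by blast
qed

section \<open>Evaluation homomorphisms of the free ring\<close>

definition eval_word :: "'b ring \<Rightarrow> ('v \<Rightarrow> 'b) \<Rightarrow> 'v list \<Rightarrow> 'b" where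
  "eval_word B \<phi> w = foldr (\<lambda>v x. \<phi> v \<otimes>\<^bsub>B\<^esub> x) w \<one>\<^bsub>B\<^esub>"

definition free_eval :: "'b ring \<Rightarrow> ('v \<Rightarrow> 'b) \<Rightarrow> ('v list \<Rightarrow> int) \<Rightarrow> 'b" where
  "free_eval B \<phi> f = finsum B (\<lambda>w. [f w] \<cdot>\<^bsub>B\<^esub> eval_word B \<phi> w) {w. f w \<noteq> 0}"

context
  fixes B :: "'b ring" and \<phi> :: "'v \<Rightarrow> 'b" and V :: "'v set"
  assumes ring_B: "ring B" and \<phi>: "\<And>v. v \<in> V \<Longrightarrow> \<phi> v \<in> carrier B"
begin

interpretation B: ring B by (rule ring_B)

lemma eval_word_closed: "set w \<subseteq> V \<Longrightarrow> eval_word B \<phi> w \<in> carrier B"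
  by (induction w) (auto simp: eval_word_def \<phi>)

lemma add_pow_closed [simp]: "x \<in> carrier B \<Longrightarrow> [(k::int)] \<cdot>\<^bsub>B\<^esub> x \<in> carrier B"
  by (rule B.add.int_pow_closed)

lemma add_pow_zero [simp]: "[(0::int)] \<cdot>\<^bsub>B\<^esub> x = \<zero>\<^bsub>B\<^esub>"
  by (simp add: add_pow_def)

lemma add_pow_one [simp]: "x \<in> carrier B \<Longrightarrow> [(1::int)] \<cdot>\<^bsub>B\<^esub> x = x"
  by (rule B.add.int_pow_1)

text \<open>The supports of two elements and of their sum differ; a common finite index set makes
  the three sums comparable.\<close>

lemma free_eval_superset:
  assumes "f \<in> carrier (free_ring V)" "finite W" "{w. f w \<noteq> 0} \<subseteq> W" "\<And>w. w \<in> W \<Longrightarrow> set w \<subseteq> V"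
  shows "free_eval B \<phi> f = finsum B (\<lambda>w. [f w] \<cdot>\<^bsub>B\<^esub> eval_word B \<phi> w) W"
  unfolding free_eval_def
  by (rule B.add.finprod_mono_neutral_cong_left)
    (use assms in \<open>auto simp: eval_word_closed\<close>)

lemma free_eval_closed: "f \<in> carrier (free_ring V) \<Longrightarrow> free_eval B \<phi> f \<in> carrier B"
  unfolding free_eval_def by (rule B.finsum_closed) (auto simp: free_ring_carrier eval_word_closed)

lemma free_eval_add:
  assumes "f \<in> carrier (free_ring V)" "g \<in> carrier (free_ring V)"
  shows "free_eval B \<phi> (f \<oplus>\<^bsub>free_ring V\<^esub> g) = free_eval B \<phi> f \<oplus>\<^bsub>B\<^esub> free_eval B \<phi> g"
proof -
  define W where "W = {w. f w \<noteq> 0} \<union> {w. g w \<noteq> 0}"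
  have W: "finite W" "\<And>w. w \<in> W \<Longrightarrow> set w \<subseteq> V"
    using assms unfolding W_def by (auto simp: free_ring_carrier)
  have "free_eval B \<phi> (f \<oplus>\<^bsub>free_ring V\<^esub> g)
      = finsum B (\<lambda>w. [(f w + g w)] \<cdot>\<^bsub>B\<^esub> eval_word B \<phi> w) W"
  proof -
    have "{w. (f \<oplus>\<^bsub>free_ring V\<^esub> g) w \<noteq> 0} \<subseteq> W" unfolding W_def by auto
    from free_eval_superset[OF free_ring.a_closed[OF assms] W(1) this W(2)] show ?thesis by simp
  qed
  also have "\<dots> = finsum B (\<lambda>w. [f w] \<cdot>\<^bsub>B\<^esub> eval_word B \<phi> w \<oplus>\<^bsub>B\<^esub> [g w] \<cdot>\<^bsub>B\<^esub> eval_word B \<phi> w) W"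
    by (rule B.finsum_cong') (use W in \<open>auto simp: eval_word_closed B.add.int_pow_mult\<close>)
  also have "\<dots> = finsum B (\<lambda>w. [f w] \<cdot>\<^bsub>B\<^esub> eval_word B \<phi> w) W
      \<oplus>\<^bsub>B\<^esub> finsum B (\<lambda>w. [g w] \<cdot>\<^bsub>B\<^esub> eval_word B \<phi> w) W"
    by (rule B.finsum_addf) (use W in \<open>auto simp: eval_word_closed\<close>)
  also have "\<dots> = free_eval B \<phi> f \<oplus>\<^bsub>B\<^esub> free_eval B \<phi> g"
    using free_eval_superset[OF assms(1) W(1)] free_eval_superset[OF assms(2) W(1)] W(2)
    by (simp add: W_def)
  finally show ?thesis .
qed

lemma free_eval_one: "free_eval B \<phi> \<one>\<^bsub>free_ring V\<^esub> = \<one>\<^bsub>B\<^esub>"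
  using B.finsum_insert[of "{}" "[]" "\<lambda>w. [(if w = [] then 1 else (0::int))] \<cdot>\<^bsub>B\<^esub> eval_word B \<phi> w"]
  by (simp add: free_eval_def eval_word_def)

text \<open>Left multiplication by a variable shifts the support injectively by prefixing a letter,
  so this case is a mere reindexing.\<close>

lemma free_eval_gen_mult:
  assumes "v \<in> V" "f \<in> carrier (free_ring V)"
  shows "free_eval B \<phi> (fgen v \<otimes>\<^bsub>free_ring V\<^esub> f) = \<phi> v \<otimes>\<^bsub>B\<^esub> free_eval B \<phi> f"
proof -
  let ?p = "fgen v \<otimes>\<^bsub>free_ring V\<^esub> f"
  let ?W = "{w. f w \<noteq> 0}"
  have W: "finite ?W" "\<And>w. w \<in> ?W \<Longrightarrow> set w \<subseteq> V" using assms(2) by (auto simp: free_ring_carrier)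
  have supp: "{w. ?p w \<noteq> 0} = (#) v ` ?W"
  proof (intro equalityI subsetI)
    fix w assume "w \<in> {w. ?p w \<noteq> 0}"
    then show "w \<in> (#) v ` ?W" by (cases w) (auto simp: fgen_mult split: if_splits)
  qed (auto simp: fgen_mult)
  have cl: "[f w] \<cdot>\<^bsub>B\<^esub> eval_word B \<phi> (v # w) \<in> carrier B" if "w \<in> ?W" for w
    by (intro add_pow_closed eval_word_closed) (use W(2)[OF that] assms(1) in auto)
  have "free_eval B \<phi> ?p = finsum B (\<lambda>w. [?p w] \<cdot>\<^bsub>B\<^esub> eval_word B \<phi> w) ((#) v ` ?W)"
    unfolding free_eval_def supp ..
  also have "\<dots> = finsum B (\<lambda>w. [?p (v # w)] \<cdot>\<^bsub>B\<^esub> eval_word B \<phi> (v # w)) ?W"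
    by (rule B.finsum_reindex) (use cl in \<open>auto simp: fgen_mult\<close>)
  also have "\<dots> = finsum B (\<lambda>w. \<phi> v \<otimes>\<^bsub>B\<^esub> ([f w] \<cdot>\<^bsub>B\<^esub> eval_word B \<phi> w)) ?W"
  proof (rule B.finsum_cong')
    show "(\<lambda>w. \<phi> v \<otimes>\<^bsub>B\<^esub> ([f w] \<cdot>\<^bsub>B\<^esub> eval_word B \<phi> w)) \<in> ?W \<rightarrow> carrier B"
      using W(2) \<phi>[OF assms(1)] eval_word_closed by auto
    show "[?p (v # w)] \<cdot>\<^bsub>B\<^esub> eval_word B \<phi> (v # w) = \<phi> v \<otimes>\<^bsub>B\<^esub> ([f w] \<cdot>\<^bsub>B\<^esub> eval_word B \<phi> w)"
      if "w \<in> ?W" for w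
      using B.add_pow_rdistr_int[OF \<phi>[OF assms(1)] eval_word_closed[OF W(2)[OF that]], of "f w"]
      by (simp add: fgen_mult eval_word_def)
  qed simp
  also have "\<dots> = \<phi> v \<otimes>\<^bsub>B\<^esub> free_eval B \<phi> f"
    unfolding free_eval_def
    by (rule B.finsum_rdistr[symmetric]) (use W \<phi>[OF assms(1)] eval_word_closed in auto)
  finally show ?thesis .
qed

lemma free_eval_gen: "v \<in> V \<Longrightarrow> free_eval B \<phi> (fgen v) = \<phi> v"
  using free_eval_gen_mult[of v "\<one>\<^bsub>free_ring V\<^esub>"] fgen_closed[of v V] \<phi>
  by (simp only: free_ring.r_one free_eval_one free_ring.one_closed B.r_one)

lemma free_eval_minus:
  assumes "f \<in> carrier (free_ring V)"
  shows "free_eval B \<phi> (\<ominus>\<^bsub>free_ring V\<^esub> f) = \<ominus>\<^bsub>B\<^esub> free_eval B \<phi> f"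
proof -
  have "free_eval B \<phi> (\<ominus>\<^bsub>free_ring V\<^esub> f) \<oplus>\<^bsub>B\<^esub> free_eval B \<phi> f = free_eval B \<phi> \<zero>\<^bsub>free_ring V\<^esub>"
    using assms by (simp only: free_eval_add[symmetric] free_ring.a_inv_closed free_ring.l_neg)
  also have "\<dots> = \<zero>\<^bsub>B\<^esub>" by (simp add: free_eval_def)
  finally show ?thesis
    using assms by (intro B.minus_equality[symmetric]) (auto simp: free_eval_closed simp del: free_ring_simps)
qed

text \<open>Induction on the left factor reduces everything to multiplication by a single variable
  and avoids manipulating the convolution sum.\<close>

lemma free_eval_mult:
  assumes "f \<in> carrier (free_ring V)" "g \<in> carrier (free_ring V)"
  shows "free_eval B \<phi> (f \<otimes>\<^bsub>free_ring V\<^esub> g) = free_eval B \<phi> f \<otimes>\<^bsub>B\<^esub> free_eval B \<phi> g"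
  using assms
proof (induction f arbitrary: g rule: free_ring_induct)
  case one
  then show ?case
    using free_eval_closed by (simp only: free_ring.l_one free_eval_one B.l_one)
next
  case (gen v)
  then show ?case by (simp only: free_eval_gen_mult free_eval_gen)
next
  case (add f f')
  then show ?case
    by (simp only: free_ring.l_distr free_eval_add free_ring.m_closed B.l_distr free_eval_closed)
next
  case (minus f)
  then show ?case
    by (simp only: free_ring.l_minus free_eval_minus free_ring.m_closed B.l_minus free_eval_closed)
next
  case (mult f f')
  then show ?case
    by (simp only: free_ring.m_assoc free_ring.m_closed B.m_assoc free_eval_closed)
qed

lemma free_eval_hom: "free_eval B \<phi> \<in> ring_hom (free_ring V) B"
  by (rule ring_hom_memI) (auto simp: free_eval_closed free_eval_mult free_eval_add free_eval_one
      simp del: free_ring_simps)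

end

section \<open>Presentation and universal property of the localization\<close>

locale ring_localization = nc_ring R
  for R :: "'a ring" (structure) +
  fixes S :: "'a set"
  assumes S_subset: "S \<subseteq> carrier R"
begin

abbreviation FR where "FR \<equiv> free_ring (loc_vars R S)"
abbreviation LR where "LR \<equiv> loc_ring R S"

lemma gen_closed:
  "r \<in> carrier R \<Longrightarrow> fgen (Inl r) \<in> carrier FR" "s \<in> S \<Longrightarrow> fgen (Inr s) \<in> carrier FR"
  by (auto intro!: fgen_closed simp: loc_vars_def)

lemma loc_rels_closed: "loc_rels R S \<subseteq> carrier FR"
proof -
  have "(\<lambda>w. fgen (Inl r) w + fgen (Inl r') w) \<in> carrier FR" if "r \<in> carrier R" "r' \<in> carrier R" for r r'
    using that by (intro free_ring_add_closed gen_closed)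
  then show ?thesis
    unfolding loc_rels_def using S_subset
    by (auto intro!: fsub_closed gen_closed free_ring.m_closed free_ring_one_closed)
qed

sublocale I: ideal "loc_ideal R S" FR
  unfolding loc_ideal_def by (rule free_ring.genideal_ideal[OF loc_rels_closed])

sublocale L: ring LR
  unfolding loc_ring_def by (rule I.quotient_is_ring)

lemma coset_hom: "(\<lambda>f. loc_ideal R S +>\<^bsub>FR\<^esub> f) \<in> ring_hom FR LR"
  unfolding loc_ring_def by (rule I.rcos_ring_hom)

lemma carrier_LR: "carrier LR = (\<lambda>f. loc_ideal R S +>\<^bsub>FR\<^esub> f) ` carrier FR"
  by (auto simp: loc_ring_def FactRing_def A_RCOSETS_def RCOSETS_def a_r_coset_def)

lemma coset_eq:
  assumes "fsub f g \<in> loc_rels R S" "f \<in> carrier FR" "g \<in> carrier FR"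
  shows "loc_ideal R S +>\<^bsub>FR\<^esub> f = loc_ideal R S +>\<^bsub>FR\<^esub> g"
proof -
  have "fsub f g \<in> loc_ideal R S"
    unfolding loc_ideal_def using free_ring.genideal_self[OF loc_rels_closed] assms(1) by blast
  then show ?thesis
    using free_ring.quotient_eq_iff_same_a_r_cos[OF I.ideal_axioms assms(2,3)] fsub_eq[OF assms(2,3)] by simp
qed

lemma loc_map_closed: "r \<in> carrier R \<Longrightarrow> loc_map R S r \<in> carrier LR"
  and loc_x_closed: "s \<in> S \<Longrightarrow> loc_x R S s \<in> carrier LR"
  unfolding loc_map_def loc_x_def carrier_LR using gen_closed by auto

lemma loc_map_hom: "loc_map R S \<in> ring_hom R LR"
proof (rule ring_hom_memI)
  fix r r' assume r: "r \<in> carrier R" "r' \<in> carrier R"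
  show "loc_map R S r \<in> carrier LR" using loc_map_closed r by blast
  note g = gen_closed(1)[OF r(1)] gen_closed(1)[OF r(2)]
  have "loc_map R S (r \<otimes> r') = loc_ideal R S +>\<^bsub>FR\<^esub> (fgen (Inl r) \<otimes>\<^bsub>FR\<^esub> fgen (Inl r'))"
    unfolding loc_map_def
    by (rule coset_eq) (use r g in \<open>auto simp: loc_rels_def intro!: gen_closed\<close>)
  then show "loc_map R S (r \<otimes> r') = loc_map R S r \<otimes>\<^bsub>LR\<^esub> loc_map R S r'"
    unfolding loc_map_def using ring_hom_mult[OF coset_hom g] by simp
  have "loc_map R S (r \<oplus> r') = loc_ideal R S +>\<^bsub>FR\<^esub> (fgen (Inl r) \<oplus>\<^bsub>FR\<^esub> fgen (Inl r'))"
    unfolding loc_map_def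
    by (rule coset_eq) (use r free_ring.a_closed[OF g] in \<open>auto simp: loc_rels_def intro!: gen_closed\<close>)
  then show "loc_map R S (r \<oplus> r') = loc_map R S r \<oplus>\<^bsub>LR\<^esub> loc_map R S r'"
    unfolding loc_map_def using ring_hom_add[OF coset_hom g] by simp
next
  have "loc_map R S \<one> = loc_ideal R S +>\<^bsub>FR\<^esub> \<one>\<^bsub>FR\<^esub>"
    unfolding loc_map_def
    by (rule coset_eq) (use free_ring.one_closed in \<open>auto simp: loc_rels_def intro!: gen_closed\<close>)
  then show "loc_map R S \<one> = \<one>\<^bsub>LR\<^esub>" using ring_hom_one[OF coset_hom] by simp
qed

lemma loc_map_x:
  assumes "s \<in> S"
  shows "loc_map R S s \<otimes>\<^bsub>LR\<^esub> loc_x R S s = \<one>\<^bsub>LR\<^esub>" "loc_x R S s \<otimes>\<^bsub>LR\<^esub> loc_map R S s = \<one>\<^bsub>LR\<^esub>"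
proof -
  have g: "fgen (Inl s) \<in> carrier FR" "fgen (Inr s) \<in> carrier FR"
    using gen_closed assms S_subset by blast+
  have "loc_ideal R S +>\<^bsub>FR\<^esub> (fgen (Inl s) \<otimes>\<^bsub>FR\<^esub> fgen (Inr s)) = loc_ideal R S +>\<^bsub>FR\<^esub> \<one>\<^bsub>FR\<^esub>"
    by (rule coset_eq) (use assms free_ring.m_closed[OF g] free_ring.one_closed in \<open>auto simp: loc_rels_def\<close>)
  then show "loc_map R S s \<otimes>\<^bsub>LR\<^esub> loc_x R S s = \<one>\<^bsub>LR\<^esub>"
    unfolding loc_map_def loc_x_def using ring_hom_mult[OF coset_hom g] ring_hom_one[OF coset_hom] by simp
  have "loc_ideal R S +>\<^bsub>FR\<^esub> (fgen (Inr s) \<otimes>\<^bsub>FR\<^esub> fgen (Inl s)) = loc_ideal R S +>\<^bsub>FR\<^esub> \<one>\<^bsub>FR\<^esub>"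
    by (rule coset_eq) (use assms free_ring.m_closed[OF g(2,1)] free_ring.one_closed in \<open>auto simp: loc_rels_def\<close>)
  then show "loc_x R S s \<otimes>\<^bsub>LR\<^esub> loc_map R S s = \<one>\<^bsub>LR\<^esub>"
    unfolding loc_map_def loc_x_def using ring_hom_mult[OF coset_hom g(2,1)] ring_hom_one[OF coset_hom] by simp
qed

lemma loc_map_Units: "s \<in> S \<Longrightarrow> loc_map R S s \<in> Units LR"
  using loc_map_x loc_map_closed loc_x_closed S_subset unfolding Units_def by blast

text \<open>Induction over the free ring descends to cosets. It is used to check surjectivity of a
  map onto a localization on generators.\<close>

lemma loc_ring_induct [consumes 1, case_names one map x add minus mult]:
  assumes "q \<in> carrier LR"
    and one: "P \<one>\<^bsub>LR\<^esub>"
    and map: "\<And>r. r \<in> carrier R \<Longrightarrow> P (loc_map R S r)"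
    and x: "\<And>s. s \<in> S \<Longrightarrow> P (loc_x R S s)"
    and add: "\<And>a b. a \<in> carrier LR \<Longrightarrow> b \<in> carrier LR \<Longrightarrow> P a \<Longrightarrow> P b \<Longrightarrow> P (a \<oplus>\<^bsub>LR\<^esub> b)"
    and minus: "\<And>a. a \<in> carrier LR \<Longrightarrow> P a \<Longrightarrow> P (\<ominus>\<^bsub>LR\<^esub> a)"
    and mult: "\<And>a b. a \<in> carrier LR \<Longrightarrow> b \<in> carrier LR \<Longrightarrow> P a \<Longrightarrow> P b \<Longrightarrow> P (a \<otimes>\<^bsub>LR\<^esub> b)"
  shows "P q"
proof -
  interpret h: ring_hom_ring FR LR "\<lambda>f. loc_ideal R S +>\<^bsub>FR\<^esub> f"
    by (intro ring_hom_ringI2 free_ring.ring_axioms L.ring_axioms coset_hom)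
  obtain f where f: "f \<in> carrier FR" "q = loc_ideal R S +>\<^bsub>FR\<^esub> f" using assms(1) carrier_LR by blast
  from f(1) have "P (loc_ideal R S +>\<^bsub>FR\<^esub> f)"
  proof (induction f rule: free_ring_induct)
    case one
    then show ?case using assms(2) by (simp only: h.hom_one)
  next
    case (gen v)
    then show ?case using map x by (auto simp: loc_vars_def loc_map_def loc_x_def)
  next
    case (add f g)
    then show ?case using assms(5) h.hom_closed by (simp only: h.hom_add)
  next
    case (minus f)
    then show ?case using assms(6) h.hom_closed by (simp only: h.hom_a_inv)
  next
    case (mult f g)
    then show ?case using assms(7) h.hom_closed by (simp only: h.hom_mult)
  qed
  then show ?thesis using f by simp
qed

text \<open>Evaluate the free ring by k on the generators from R and by inverses on the x_s. Each of
  the five families of relations is sent to zero, so the evaluation factors through the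
  quotient.\<close>

lemma loc_ring_universal:
  fixes B :: "'c ring"
  assumes B: "ring B" and k: "k \<in> ring_hom R B" and kU: "\<And>s. s \<in> S \<Longrightarrow> k s \<in> Units B"
  obtains g where "g \<in> ring_hom LR B" "\<And>r. r \<in> carrier R \<Longrightarrow> g (loc_map R S r) = k r"
proof -
  interpret B: ring B by fact
  define \<phi> where "\<phi> v = (case v of Inl r \<Rightarrow> k r | Inr s \<Rightarrow> inv\<^bsub>B\<^esub> (k s))" for v
  have \<phi>: "\<phi> v \<in> carrier B" if "v \<in> loc_vars R S" for v
    using that ring_hom_closed[OF k] kU by (auto simp: loc_vars_def \<phi>_def)
  interpret E: ring_hom_ring FR B "free_eval B \<phi>"
    by (intro ring_hom_ringI2 free_ring.ring_axioms B free_eval_hom[OF B \<phi>])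
  have gen [simp]: "free_eval B \<phi> (fgen (Inl r)) = k r" if "r \<in> carrier R" for r
    using free_eval_gen[where \<phi> = \<phi> and V = "loc_vars R S" and v = "Inl r", OF B \<phi>] that by (simp add: loc_vars_def \<phi>_def)
  have gen' [simp]: "free_eval B \<phi> (fgen (Inr s)) = inv\<^bsub>B\<^esub> (k s)" if "s \<in> S" for s
    using free_eval_gen[where \<phi> = \<phi> and V = "loc_vars R S" and v = "Inr s", OF B \<phi>] that by (simp add: loc_vars_def \<phi>_def)
  have sub: "free_eval B \<phi> (fsub f g) = \<zero>\<^bsub>B\<^esub>"
    if "f \<in> carrier FR" "g \<in> carrier FR" "free_eval B \<phi> f = free_eval B \<phi> g" for f g
    using that fsub_eq[OF that(1,2)] by (simp add: a_minus_def B.r_neg del: free_ring_simps)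
  have "free_eval B \<phi> f = \<zero>\<^bsub>B\<^esub>" if "f \<in> loc_rels R S" for f
  proof -
    have add: "(\<lambda>w. fgen (Inl r) w + fgen (Inl r') w) = fgen (Inl r) \<oplus>\<^bsub>FR\<^esub> fgen (Inl r')" for r r' by simp
    note [simp] = gen_closed ring_hom_add[OF k] ring_hom_mult[OF k] ring_hom_one[OF k] ring_hom_closed[OF k]
    note [simp del] = free_ring_simps
    have SR: "s \<in> carrier R" if "s \<in> S" for s using that S_subset by blast
    show ?thesis
      using that unfolding loc_rels_def add
    proof (elim UnE CollectE exE conjE singletonE, goal_cases)
      case (1 r r')
      show ?case unfolding 1(1) by (rule sub) (use 1 in simp_all)
    next
      case (2 r r')
      show ?case unfolding 2(1) by (rule sub) (use 2 in simp_all)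
    next
      case 3
      show ?case unfolding 3 by (rule sub) simp_all
    next
      case (4 s)
      show ?case unfolding 4(1) by (rule sub) (use 4 SR kU in simp_all)
    next
      case (5 s)
      show ?case unfolding 5(1) by (rule sub) (use 5 SR kU in simp_all)
    qed
  qed
  then have "loc_rels R S \<subseteq> a_kernel FR B (free_eval B \<phi>)"
    unfolding a_kernel_def' using loc_rels_closed by blast
  then have "loc_ideal R S \<subseteq> a_kernel FR B (free_eval B \<phi>)"
    unfolding loc_ideal_def by (intro free_ring.genideal_minimal E.kernel_is_ideal)
  then have I0: "free_eval B \<phi> i = \<zero>\<^bsub>B\<^esub>" if "i \<in> loc_ideal R S" for i
    using that unfolding a_kernel_def' by blast
  \<comment> \<open>Well defined because the evaluation is constant on cosets of
    \<open>loc_ideal R S\<close>, so each image is a singleton.\<close>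
  define g where "g U = the_elem (free_eval B \<phi> ` U)" for U
  have g: "g (loc_ideal R S +>\<^bsub>FR\<^esub> f) = free_eval B \<phi> f" if f: "f \<in> carrier FR" for f
  proof -
    have "free_eval B \<phi> (i \<oplus>\<^bsub>FR\<^esub> f) = free_eval B \<phi> f" if "i \<in> loc_ideal R S" for i
      using that f I0[OF that] I.Icarr[OF that] by (simp del: free_ring_simps)
    then have "free_eval B \<phi> ` (loc_ideal R S +>\<^bsub>FR\<^esub> f) \<subseteq> {free_eval B \<phi> f}"
      by (auto simp: a_r_coset_def r_coset_def simp del: free_ring_simps)
    moreover have "f \<in> loc_ideal R S +>\<^bsub>FR\<^esub> f" using I.a_rcos_self[OF f] .
    ultimately have "free_eval B \<phi> ` (loc_ideal R S +>\<^bsub>FR\<^esub> f) = {free_eval B \<phi> f}" by blast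
    then show ?thesis unfolding g_def by simp
  qed
  interpret h: ring_hom_ring FR LR "\<lambda>f. loc_ideal R S +>\<^bsub>FR\<^esub> f"
    by (intro ring_hom_ringI2 free_ring.ring_axioms L.ring_axioms coset_hom)
  have "g \<in> ring_hom LR B"
  proof (rule ring_hom_memI)
    fix a b assume a: "a \<in> carrier LR" and b: "b \<in> carrier LR"
    obtain f where f1: "a = loc_ideal R S +>\<^bsub>FR\<^esub> f" "f \<in> carrier FR"
      using a unfolding carrier_LR by (rule imageE)
    obtain f' where f2: "b = loc_ideal R S +>\<^bsub>FR\<^esub> f'" "f' \<in> carrier FR"
      using b unfolding carrier_LR by (rule imageE)
    note f = f1(2,1) f2(2,1)
    show "g a \<in> carrier B" unfolding f(2) g[OF f(1)] by (rule E.hom_closed[OF f(1)])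
    show "g (a \<otimes>\<^bsub>LR\<^esub> b) = g a \<otimes>\<^bsub>B\<^esub> g b"
      using g[OF free_ring.m_closed[OF f(1,3)]] g[OF f(1)] g[OF f(3)]
      unfolding f(2,4) h.hom_mult[OF f(1,3)] E.hom_mult[OF f(1,3)] by (simp only:)
    show "g (a \<oplus>\<^bsub>LR\<^esub> b) = g a \<oplus>\<^bsub>B\<^esub> g b"
      using g[OF free_ring.a_closed[OF f(1,3)]] g[OF f(1)] g[OF f(3)]
      unfolding f(2,4) h.hom_add[OF f(1,3)] E.hom_add[OF f(1,3)] by (simp only:)
  next
    show "g \<one>\<^bsub>LR\<^esub> = \<one>\<^bsub>B\<^esub>"
      using g[OF free_ring.one_closed] unfolding h.hom_one E.hom_one .
  qed
  moreover have "g (loc_map R S r) = k r" if "r \<in> carrier R" for r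
    using g[OF gen_closed(1)[OF that]] gen[OF that] by (simp add: loc_map_def)
  ultimately show thesis using that by blast
qed

end

section \<open>Localizable sets with simple Artinian localizations\<close>

lemma ass_eq_a_kernel: "ass R S = a_kernel R (loc_ring R S) (loc_map R S)"
  by (simp add: ass_def a_kernel_def')

context ring_localization
begin

sublocale map: ring_hom_ring R LR "loc_map R S"
  by (intro ring_hom_ringI2 ring_axioms L.ring_axioms loc_map_hom)

lemma left_fractions_loc_ring:
  assumes "mult_set R S" "left_localizable R S"
  shows "left_fractions R LR (loc_map R S) S"
proof unfold_locales
  fix q assume q: "q \<in> carrier LR"
  obtain s r where s: "s \<in> S" "r \<in> carrier R" "q = loc_x R S s \<otimes>\<^bsub>LR\<^esub> loc_map R S r"
    using assms(2) q unfolding left_localizable_def by blast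
  have "loc_map R S s \<otimes>\<^bsub>LR\<^esub> q = loc_map R S r"
    using s(1,2) loc_map_x[OF s(1)] loc_x_closed[OF s(1)] S_subset
    by (simp add: s(3) L.m_assoc[symmetric] subset_iff)
  then show "\<exists>s\<in>S. \<exists>r\<in>carrier R. loc_map R S s \<otimes>\<^bsub>LR\<^esub> q = loc_map R S r" using s by blast
qed (use assms(1) loc_map_Units in \<open>auto simp: mult_set_def\<close>)

lemma right_fractions_loc_ring:
  assumes "mult_set R S" "right_localizable R S"
  shows "left_fractions (op_ring R) (op_ring LR) (loc_map R S) S"
proof -
  interpret op: ring_hom_ring "op_ring R" "op_ring LR" "loc_map R S"
    by (intro ring_hom_ringI2) (auto simp: ring_axioms L.ring_axioms loc_map_hom)
  show ?thesis
  proof unfold_locales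
    fix q assume "q \<in> carrier (op_ring LR)"
    then have q: "q \<in> carrier LR" by simp
    obtain s r where s: "s \<in> S" "r \<in> carrier R" "q = loc_map R S r \<otimes>\<^bsub>LR\<^esub> loc_x R S s"
      using assms(2) q unfolding right_localizable_def by blast
    have "q \<otimes>\<^bsub>LR\<^esub> loc_map R S s = loc_map R S r"
      using s(1,2) loc_map_x[OF s(1)] loc_x_closed[OF s(1)] S_subset
      by (simp add: s(3) L.m_assoc subset_iff)
    then show "\<exists>s\<in>S. \<exists>r\<in>carrier (op_ring R). loc_map R S s \<otimes>\<^bsub>op_ring LR\<^esub> q = loc_map R S r"
      using s by auto
  qed (use assms(1) loc_map_Units in \<open>auto simp: mult_set_def\<close>)
qed

text \<open>The universal property at S gives g from the localization at S to the one at C. It is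
  onto, as the elements of C are already invertible in its source, so fractions over S represent
  everything in its target. The map k in the other direction rules out that the target is
  zero.\<close>

lemma localizable_superset:
  assumes loc: "localizable sd R S" and C: "mult_set R C" "S \<subseteq> C"
    and U: "\<And>c. c \<in> C \<Longrightarrow> loc_map R S c \<in> Units LR"
  shows "localizable sd R C"
proof -
  interpret C: ring_localization R C
    by unfold_locales (use C(1) in \<open>auto simp: mult_set_def\<close>)
  obtain k where k: "k \<in> ring_hom C.LR LR" "\<And>r. r \<in> carrier R \<Longrightarrow> k (loc_map R C r) = loc_map R S r"
    using C.loc_ring_universal[OF L.ring_axioms loc_map_hom U] by blast
  obtain g where g: "g \<in> ring_hom LR C.LR" "\<And>r. r \<in> carrier R \<Longrightarrow> g (loc_map R S r) = loc_map R C r"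
    using loc_ring_universal[OF C.L.ring_axioms C.loc_map_hom] C.loc_map_Units C(2) by blast
  interpret k: ring_hom_ring C.LR LR k by (intro ring_hom_ringI2 L.ring_axioms C.L.ring_axioms k)
  interpret g: ring_hom_ring LR C.LR g by (intro ring_hom_ringI2 L.ring_axioms C.L.ring_axioms g)
  \<comment> \<open>By uniqueness of inverses, an inverse in the source is sent to the variable of
    the target. This serves the new variables for surjectivity and the old ones for the form of
    fractions.\<close>
  have g_inv: "g y = loc_x R C c"
    if "c \<in> C" "y \<in> carrier LR" "y \<otimes>\<^bsub>LR\<^esub> loc_map R S c = \<one>\<^bsub>LR\<^esub>" for c y
  proof -
    have c: "c \<in> carrier R" using that(1) C.S_subset by blast
    have "g y \<otimes>\<^bsub>C.LR\<^esub> loc_map R C c = \<one>\<^bsub>C.LR\<^esub>"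
      using that(2,3) c g.hom_mult[of y "loc_map R S c"] by (simp add: g(2))
    then show ?thesis
      using C.L.inv_unique[OF _ C.loc_map_x(1)[OF that(1)]] that(2) c C.loc_x_closed[OF that(1)] by simp
  qed
  have surj: "x \<in> g ` carrier LR" if "x \<in> carrier C.LR" for x
    using that
  proof (induction x rule: C.loc_ring_induct)
    case one
    then show ?case using g.hom_one L.one_closed by (metis imageI)
  next
    case (map r)
    then show ?case using g(2) loc_map_closed by (metis imageI)
  next
    case (x c)
    then show ?case
      using g_inv[of c "inv\<^bsub>LR\<^esub> (loc_map R S c)"] U[OF x] L.Units_inv_closed L.Units_l_inv
      by (metis imageI)
  next
    case (add a b)
    then obtain a' b' where "a' \<in> carrier LR" "b' \<in> carrier LR" "a = g a'" "b = g b'" by blast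
    then show ?case by (intro image_eqI[of _ g "a' \<oplus>\<^bsub>LR\<^esub> b'"]) simp_all
  next
    case (minus a)
    then obtain a' where "a' \<in> carrier LR" "a = g a'" by blast
    then show ?case by (intro image_eqI[of _ g "\<ominus>\<^bsub>LR\<^esub> a'"]) simp_all
  next
    case (mult a b)
    then obtain a' b' where "a' \<in> carrier LR" "b' \<in> carrier LR" "a = g a'" "b = g b'" by blast
    then show ?case by (intro image_eqI[of _ g "a' \<otimes>\<^bsub>LR\<^esub> b'"]) simp_all
  qed
  have gx: "g (loc_x R S s) = loc_x R C s" if "s \<in> S" for s
    by (rule g_inv[OF subsetD[OF C(2) that] loc_x_closed[OF that] loc_map_x(2)[OF that]])
  have nontrivial: "carrier C.LR \<noteq> {\<zero>\<^bsub>C.LR\<^esub>}" if "carrier LR \<noteq> {\<zero>\<^bsub>LR\<^esub>}"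
  proof
    assume "carrier C.LR = {\<zero>\<^bsub>C.LR\<^esub>}"
    then have "\<one>\<^bsub>C.LR\<^esub> = \<zero>\<^bsub>C.LR\<^esub>" using C.L.one_closed by blast
    then have "\<one>\<^bsub>LR\<^esub> = \<zero>\<^bsub>LR\<^esub>" using k.hom_one k.hom_zero by simp
    then show False using that L.one_zeroD by simp
  qed
  have left: "left_localizable R C" if l: "left_localizable R S"
    unfolding left_localizable_def
  proof (intro conjI ballI)
    show "carrier C.LR \<noteq> {\<zero>\<^bsub>C.LR\<^esub>}" using nontrivial l by (simp add: left_localizable_def)
    fix x assume "x \<in> carrier C.LR"
    then obtain q where q: "q \<in> carrier LR" "x = g q" using surj by blast
    obtain s r where s: "s \<in> S" "r \<in> carrier R" "q = loc_x R S s \<otimes>\<^bsub>LR\<^esub> loc_map R S r"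
      using l q(1) unfolding left_localizable_def by blast
    have "x = loc_x R C s \<otimes>\<^bsub>C.LR\<^esub> loc_map R C r"
      using s(1,2) loc_x_closed g(2) gx by (simp add: q(2) s(3))
    then show "\<exists>s\<in>C. \<exists>r\<in>carrier R. x = loc_x R C s \<otimes>\<^bsub>C.LR\<^esub> loc_map R C r" using s C(2) by blast
  qed
  have right: "right_localizable R C" if l: "right_localizable R S"
    unfolding right_localizable_def
  proof (intro conjI ballI)
    show "carrier C.LR \<noteq> {\<zero>\<^bsub>C.LR\<^esub>}" using nontrivial l by (simp add: right_localizable_def)
    fix x assume "x \<in> carrier C.LR"
    then obtain q where q: "q \<in> carrier LR" "x = g q" using surj by blast
    obtain s r where s: "s \<in> S" "r \<in> carrier R" "q = loc_map R S r \<otimes>\<^bsub>LR\<^esub> loc_x R S s"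
      using l q(1) unfolding right_localizable_def by blast
    have "x = loc_map R C r \<otimes>\<^bsub>C.LR\<^esub> loc_x R C s"
      using s(1,2) loc_x_closed g(2) gx by (simp add: q(2) s(3))
    then show "\<exists>s\<in>C. \<exists>r\<in>carrier R. x = loc_map R C r \<otimes>\<^bsub>C.LR\<^esub> loc_x R C s" using s C(2) by blast
  qed
  show ?thesis
    using loc left right C(1) by (cases sd) (auto simp: localizable_def)
qed

text \<open>The universal property provides a ring map between the two localizations; its source is
  simple and its target nonzero, so it is injective.\<close>

lemma simple_hom_loc_ring_inj:
  assumes "simple_ring LR" "ring_localization R T" "S \<subseteq> T"
    and "carrier (loc_ring R T) \<noteq> {\<zero>\<^bsub>loc_ring R T\<^esub>}"
    and r: "r \<in> carrier R" "loc_map R T r = \<zero>\<^bsub>loc_ring R T\<^esub>"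
  shows "loc_map R S r = \<zero>\<^bsub>LR\<^esub>"
proof -
  interpret T: ring_localization R T by fact
  obtain g where g: "g \<in> ring_hom LR T.LR" "\<And>r. r \<in> carrier R \<Longrightarrow> g (loc_map R S r) = loc_map R T r"
    using loc_ring_universal[OF T.L.ring_axioms T.loc_map_hom] T.loc_map_Units assms(3) by blast
  interpret g: ring_hom_ring LR T.LR g by (intro ring_hom_ringI2 L.ring_axioms T.L.ring_axioms g)
  have "\<one>\<^bsub>LR\<^esub> \<notin> a_kernel LR T.LR g"
  proof
    assume "\<one>\<^bsub>LR\<^esub> \<in> a_kernel LR T.LR g"
    then have "\<one>\<^bsub>T.LR\<^esub> = \<zero>\<^bsub>T.LR\<^esub>" unfolding a_kernel_def' g.hom_one[symmetric] by blast
    then show False using assms(4) T.L.one_zeroD by simp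
  qed
  then have "a_kernel LR T.LR g \<noteq> carrier LR" using L.one_closed by metis
  moreover have "a_kernel LR T.LR g = {\<zero>\<^bsub>LR\<^esub>} \<or> a_kernel LR T.LR g = carrier LR"
    using assms(1) g.kernel_is_ideal unfolding simple_ring_def by simp
  ultimately have "a_kernel LR T.LR g = {\<zero>\<^bsub>LR\<^esub>}" by simp
  moreover have "loc_map R S r \<in> a_kernel LR T.LR g"
    unfolding a_kernel_def' using loc_map_closed[OF r(1)] g(2)[OF r(1)] r(2) by (intro CollectI conjI) simp_all
  ultimately show ?thesis by simp
qed

text \<open>The hypotheses \<open>C_eq\<close> and \<open>U\<close> are invariant under passing to opposite rings, which lets
  one argument cover the left and the right case.\<close>

lemma max_localizable_C_of:
  assumes loc: "localizable sd R S" and simple: "simple_ring LR"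
    and C_eq: "C_of R (ass R S) = {c \<in> carrier R. loc_map R S c \<in> Units LR}"
    and U: "\<And>t. t \<in> carrier R \<Longrightarrow>
      (\<And>r. r \<in> carrier R \<Longrightarrow> loc_map R S (r \<otimes> t) = \<zero>\<^bsub>LR\<^esub> \<or> loc_map R S (t \<otimes> r) = \<zero>\<^bsub>LR\<^esub>
        \<Longrightarrow> loc_map R S r = \<zero>\<^bsub>LR\<^esub>) \<Longrightarrow> loc_map R S t \<in> Units LR"
  shows "max_localizable sd R (C_of R (ass R S))"
proof -
  let ?C = "C_of R (ass R S)"
  have SC: "S \<subseteq> ?C" unfolding C_eq using S_subset loc_map_Units by auto
  have "\<one>\<^bsub>LR\<^esub> \<noteq> \<zero>\<^bsub>LR\<^esub>" using simple L.one_zeroD unfolding simple_ring_def by blast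
  then have "\<zero>\<^bsub>LR\<^esub> \<notin> Units LR"
    using L.Units_r_inv L.Units_inv_closed L.l_null by metis
  then have "mult_set R ?C"
    unfolding mult_set_def C_eq by auto
  then have "localizable sd R ?C"
    by (rule localizable_superset[OF loc _ SC]) (simp add: C_eq)
  \<comment> \<open>By \<open>inj\<close> and \<open>inj'\<close> the maps from R to the
    localizations at S and at T have the same kernel. Since t is a unit at T, it is regular modulo
    this kernel, and \<open>U\<close> makes it a unit at S.\<close>
  moreover have "T \<subseteq> ?C" if T: "localizable sd R T" "?C \<subseteq> T" for T
  proof
    fix t assume t: "t \<in> T"
    have Tc: "T \<subseteq> carrier R" using T(1) by (simp add: localizable_def mult_set_def)
    have T0: "carrier (loc_ring R T) \<noteq> {\<zero>\<^bsub>loc_ring R T\<^esub>}"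
      using T(1) by (cases sd) (auto simp: localizable_def left_localizable_def right_localizable_def)
    interpret T: ring_localization R T by unfold_locales (rule Tc)
    have tc: "t \<in> carrier R" using t Tc by blast
    have tU: "loc_map R T t \<in> Units T.LR" using t by (rule T.loc_map_Units)
    have inj: "loc_map R S r = \<zero>\<^bsub>LR\<^esub>" if "r \<in> carrier R" "loc_map R T r = \<zero>\<^bsub>T.LR\<^esub>" for r
      using simple_hom_loc_ring_inj[OF simple T.ring_localization_axioms _ T0 that] SC T(2) by blast
    have inj': "loc_map R T r = \<zero>\<^bsub>T.LR\<^esub>" if r: "r \<in> carrier R" "loc_map R S r = \<zero>\<^bsub>LR\<^esub>" for r
    proof -
      obtain g where g: "g \<in> ring_hom LR T.LR" "\<And>r. r \<in> carrier R \<Longrightarrow> g (loc_map R S r) = loc_map R T r"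
        using loc_ring_universal[OF T.L.ring_axioms T.loc_map_hom] T.loc_map_Units SC T(2) by blast
      interpret g: ring_hom_ring LR T.LR g by (intro ring_hom_ringI2 L.ring_axioms T.L.ring_axioms g)
      show ?thesis using g(2)[OF r(1)] r(2) by simp
    qed
    have "loc_map R S t \<in> Units LR"
    proof (rule U[OF tc])
      fix r assume r: "r \<in> carrier R"
        "loc_map R S (r \<otimes> t) = \<zero>\<^bsub>LR\<^esub> \<or> loc_map R S (t \<otimes> r) = \<zero>\<^bsub>LR\<^esub>"
      then have "loc_map R T r \<otimes>\<^bsub>T.LR\<^esub> loc_map R T t = \<zero>\<^bsub>T.LR\<^esub> \<or>
          loc_map R T t \<otimes>\<^bsub>T.LR\<^esub> loc_map R T r = \<zero>\<^bsub>T.LR\<^esub>"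
        using inj'[of "r \<otimes> t"] inj'[of "t \<otimes> r"] tc by auto
      then have "loc_map R T r = \<zero>\<^bsub>T.LR\<^esub>"
      proof
        assume "loc_map R T r \<otimes>\<^bsub>T.LR\<^esub> loc_map R T t = \<zero>\<^bsub>T.LR\<^esub>"
        then have "loc_map R T r \<otimes>\<^bsub>T.LR\<^esub> loc_map R T t \<otimes>\<^bsub>T.LR\<^esub> inv\<^bsub>T.LR\<^esub> (loc_map R T t) = \<zero>\<^bsub>T.LR\<^esub>"
          using tU by simp
        then show ?thesis using tU tc r(1) by (simp add: T.L.m_assoc)
      next
        assume "loc_map R T t \<otimes>\<^bsub>T.LR\<^esub> loc_map R T r = \<zero>\<^bsub>T.LR\<^esub>"
        then have "inv\<^bsub>T.LR\<^esub> (loc_map R T t) \<otimes>\<^bsub>T.LR\<^esub> (loc_map R T t \<otimes>\<^bsub>T.LR\<^esub> loc_map R T r) = \<zero>\<^bsub>T.LR\<^esub>"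
          using tU by simp
        then show ?thesis using tU tc r(1) by (simp add: T.L.m_assoc[symmetric])
      qed
      then show "loc_map R S r = \<zero>\<^bsub>LR\<^esub>" using inj r(1) by blast
    qed
    then show "t \<in> ?C" unfolding C_eq using tc by simp
  qed
  ultimately show ?thesis unfolding max_localizable_def by blast
qed

end

section \<open>Combining the left and the right case\<close>

context fraction_family
begin

text \<open>Gathers the facts about one factor in terms of R, \<open>Q i\<close>, \<open>h i\<close>
  and \<open>D i\<close> alone, so that instantiation with opposite rings followed by simplification
  yields the right-hand facts.\<close>

lemma kernel_quotient:
  assumes "i < n"
  shows "semiprime (R Quot kern i)" "left_goldie (R Quot kern i)"
    "is_lcq (R Quot kern i) (Q i) (\<lambda>U. the_elem (h i ` U))"
    "\<And>r. r \<in> carrier R \<Longrightarrow> the_elem (h i ` (kern i +> r)) = h i r"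
    "C_of R (kern i) = {c \<in> carrier R. h i c \<in> Units (Q i)}" "D i \<subseteq> C_of R (kern i)"
    "\<And>t. t \<in> carrier R \<Longrightarrow> (\<And>r. r \<in> carrier R \<Longrightarrow> h i (r \<otimes> t) = \<zero>\<^bsub>Q i\<^esub> \<or> h i (t \<otimes> r) = \<zero>\<^bsub>Q i\<^esub>
        \<Longrightarrow> h i r = \<zero>\<^bsub>Q i\<^esub>) \<Longrightarrow> h i t \<in> Units (Q i)"
proof -
  interpret F: simple_left_fractions R "Q i" "h i" "D i" using fractions assms .
  interpret q: injective_left_fractions "R Quot kern i" "Q i" F.quot_map "(+>) (kern i) ` D i"
    by (rule F.injective_quot_map)
  have qm: "F.quot_map = (\<lambda>U. the_elem (h i ` U))" by (simp add: F.quot_map_def fun_eq_iff)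
  show "semiprime (R Quot kern i)" "left_goldie (R Quot kern i)"
    "is_lcq (R Quot kern i) (Q i) (\<lambda>U. the_elem (h i ` U))"
    using q.semiprime q.left_goldie q.is_lcq unfolding qm by blast+
  show "\<And>r. r \<in> carrier R \<Longrightarrow> the_elem (h i ` (kern i +> r)) = h i r"
    by (rule F.the_elem_simp)
  show "C_of R (kern i) = {c \<in> carrier R. h i c \<in> Units (Q i)}"
    using F.C_of_kernel_Units F.Units_C_of_kernel by (auto simp: C_of_def)
  show "D i \<subseteq> C_of R (kern i)" by (rule F.D_subset_C_of)
  show "h i t \<in> Units (Q i)" if "t \<in> carrier R"
    "\<And>r. r \<in> carrier R \<Longrightarrow> h i (r \<otimes> t) = \<zero>\<^bsub>Q i\<^esub> \<or> h i (t \<otimes> r) = \<zero>\<^bsub>Q i\<^esub> \<Longrightarrow> h i r = \<zero>\<^bsub>Q i\<^esub>" for t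
    by (rule F.h_Units[OF that(1)]) (rule that(2), assumption, rule disjI1)
qed

end

theorem theorem1p13:
  fixes R :: "'a ring" and sd :: side and n :: nat and S :: "nat \<Rightarrow> 'a set"
  assumes "ring R"
    and loc: "\<forall>i<n. localizable sd R (S i)"
    and art: "\<forall>i<n. simple_artinian (loc_ring R (S i))"
    and int0: "carrier R \<inter> (\<Inter>i\<in>{..<n}. ass R (S i)) = {\<zero>\<^bsub>R\<^esub>}"
    and intne: "\<forall>i<n. carrier R \<inter> (\<Inter>j\<in>{..<n} - {i}. ass R (S j)) \<noteq> {\<zero>\<^bsub>R\<^esub>}"
  shows "(\<forall>i<n. semiprime (R Quot ass R (S i)) \<and> goldie sd (R Quot ass R (S i)))
    \<and> min_primes R = ass R ` S ` {..<n}
    \<and> (\<forall>i<n. \<exists>\<sigma>. is_clq sd (R Quot ass R (S i)) (loc_ring R (S i)) \<sigma> \<and>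
            (\<forall>r\<in>carrier R. \<sigma> (ass R (S i) +>\<^bsub>R\<^esub> r) = loc_map R (S i) r))
    \<and> (\<forall>i<n. S i \<subseteq> C_of R (ass R (S i)))
    \<and> (\<exists>\<sigma>. is_clq sd R (prod_ring n (\<lambda>i. loc_ring R (S i))) \<sigma>)
    \<and> (\<forall>i<n. max_localizable sd R (C_of R (ass R (S i))))"
proof -
  interpret R: nc_ring R using assms(1) by (simp add: nc_ring_iff)
  define Q where "Q i = loc_ring R (S i)" for i
  define h where "h i = loc_map R (S i)" for i
  have ms: "mult_set R (S i)" if "i < n" for i using loc that by (simp add: localizable_def)
  have L: "ring_localization R (S i)" if "i < n" for i
    using ms[OF that] by unfold_locales (simp add: mult_set_def)
  have kern: "ass R (S i) = a_kernel R (Q i) (h i)" for i by (simp add: ass_eq_a_kernel Q_def h_def)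
  have simple: "simple_artinian (Q i)" if "i < n" for i using art that by (simp add: Q_def)
  have ringQ: "nc_ring (Q i)" if "i < n" for i
    using simple[OF that] by (simp add: nc_ring_iff simple_artinian_def simple_ring_def)
  have faithful: "r = \<zero>\<^bsub>R\<^esub>" if "r \<in> carrier R" "\<And>i. i < n \<Longrightarrow> h i r = \<zero>\<^bsub>Q i\<^esub>" for r
  proof -
    have "r \<in> carrier R \<inter> (\<Inter>i\<in>{..<n}. ass R (S i))"
      using that by (auto simp: kern a_kernel_def')
    then show ?thesis using int0 by simp
  qed
  have irredundant: "\<exists>r\<in>carrier R. r \<noteq> \<zero>\<^bsub>R\<^esub> \<and> (\<forall>j<n. j \<noteq> i \<longrightarrow> h j r = \<zero>\<^bsub>Q j\<^esub>)" if i: "i < n" for i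
  proof -
    \<comment> \<open>The intersection contains zero, so being different from the zero set means
      having a nonzero element.\<close>
    have "\<zero>\<^bsub>R\<^esub> \<in> carrier R \<inter> (\<Inter>j\<in>{..<n} - {i}. ass R (S j))"
      using int0 by auto
    then obtain r where r: "r \<in> carrier R \<inter> (\<Inter>j\<in>{..<n} - {i}. ass R (S j))" "r \<noteq> \<zero>\<^bsub>R\<^esub>"
      using intne i by blast
    then show ?thesis by (intro bexI[of _ r]) (auto simp: kern a_kernel_def')
  qed
  \<comment> \<open>For \<open>Both\<close>, this instance and the opposite one below are available
    together, and their conclusions combine to the two-sided ones.\<close>
  have left: "fraction_family R n Q h S" if "sd \<noteq> Right"
  proof (intro fraction_family.intro fraction_family_axioms.intro R.nc_ring_axioms)
    fix i assume i: "i < n"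
    have "left_localizable R (S i)" using loc i that by (cases sd) (auto simp: localizable_def)
    then show "simple_left_fractions R (Q i) (h i) (S i)"
      using ring_localization.left_fractions_loc_ring[OF L[OF i] ms[OF i]] simple[OF i]
      by (simp add: simple_left_fractions_def simple_left_fractions_axioms_def Q_def h_def)
  qed (use faithful irredundant in auto)
  have right: "fraction_family (op_ring R) n (\<lambda>i. op_ring (Q i)) h S" if "sd \<noteq> Left"
  proof (intro fraction_family.intro fraction_family_axioms.intro R.nc_ring_op_ring)
    fix i assume i: "i < n"
    have "right_localizable R (S i)" using loc i that by (cases sd) (auto simp: localizable_def)
    then show "simple_left_fractions (op_ring R) (op_ring (Q i)) (h i) (S i)"
      using ring_localization.right_fractions_loc_ring[OF L[OF i] ms[OF i]]
        nc_ring.simple_artinian_op_ring[OF ringQ[OF i] simple[OF i]]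
      by (simp add: simple_left_fractions_def simple_left_fractions_axioms_def Q_def h_def)
  qed (use faithful irredundant in auto)
  note l = fraction_family.kernel_quotient[OF left]
  note r = fraction_family.kernel_quotient[OF right, simplified]
  \<comment> \<open>Conclusions that do not mention the side are taken from whichever of the two
    instances exists.\<close>
  have sides: "sd \<noteq> Right \<or> sd \<noteq> Left" by auto
  have coset: "the_elem (h i ` (ass R (S i) +>\<^bsub>R\<^esub> x)) = loc_map R (S i) x"
    if "i < n" "x \<in> carrier R" for i x
    using sides l(4)[OF _ that] r(4)[OF _ that] unfolding kern h_def[symmetric] by blast
  have C_eq: "C_of R (ass R (S i)) = {c \<in> carrier R. h i c \<in> Units (Q i)}" if "i < n" for i
    using sides l(5) r(5) that unfolding kern by blast
  have p1: "semiprime (R Quot ass R (S i)) \<and> goldie sd (R Quot ass R (S i))" if "i < n" for i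
    using l(1,2)[OF _ that] r(1,2)[OF _ that] unfolding kern by (cases sd) (auto simp: goldie_def)
  have p2: "min_primes R = ass R ` S ` {..<n}"
    using sides fraction_family.min_primes_eq[OF left] fraction_family.min_primes_eq[OF right, simplified]
    unfolding image_image kern by blast
  have p3: "is_clq sd (R Quot ass R (S i)) (loc_ring R (S i)) (\<lambda>U. the_elem (h i ` U))"
    if "i < n" for i
    using l(3)[OF _ that] r(3)[OF _ that] unfolding kern Q_def[symmetric]
    by (cases sd) (auto simp: is_clq_def)
  have p4: "S i \<subseteq> C_of R (ass R (S i))" if "i < n" for i
    using sides l(6)[OF _ that] r(6)[OF _ that] unfolding kern by blast
  \<comment> \<open>\<open>prod_map\<close> depends on n and h only, so the same map serves as left
    and as right quotient map.\<close>
  have p5: "is_clq sd R (prod_ring n (\<lambda>i. loc_ring R (S i))) (fraction_family.prod_map n h)"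
    using fraction_family.is_lcq_prod[OF left] fraction_family.is_lcq_prod[OF right, simplified]
    unfolding Q_def[symmetric] by (cases sd) (auto simp: is_clq_def)
  have p6: "max_localizable sd R (C_of R (ass R (S i)))" if i: "i < n" for i
  proof (rule ring_localization.max_localizable_C_of[OF L[OF i]])
    show "localizable sd R (S i)" using loc i by simp
    show "simple_ring (loc_ring R (S i))" using art i by (simp add: simple_artinian_def)
    show "C_of R (ass R (S i)) = {c \<in> carrier R. loc_map R (S i) c \<in> Units (loc_ring R (S i))}"
      using C_eq[OF i] by (simp add: Q_def h_def)
    fix t assume t: "t \<in> carrier R"
      and *: "\<And>x. x \<in> carrier R \<Longrightarrow> loc_map R (S i) (x \<otimes>\<^bsub>R\<^esub> t) = \<zero>\<^bsub>loc_ring R (S i)\<^esub> \<or>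
          loc_map R (S i) (t \<otimes>\<^bsub>R\<^esub> x) = \<zero>\<^bsub>loc_ring R (S i)\<^esub> \<Longrightarrow> loc_map R (S i) x = \<zero>\<^bsub>loc_ring R (S i)\<^esub>"
    have "h i t \<in> Units (Q i)"
      using sides
    proof
      assume "sd \<noteq> Right"
      then show ?thesis by (rule l(7)[OF _ i t]) (use * in \<open>auto simp: h_def Q_def\<close>)
    next
      assume "sd \<noteq> Left"
      then show ?thesis by (rule r(7)[OF _ i t]) (use * in \<open>auto simp: h_def Q_def\<close>)
    qed
    then show "loc_map R (S i) t \<in> Units (loc_ring R (S i))" by (simp add: h_def Q_def)
  qed
  have p3': "\<exists>\<sigma>. is_clq sd (R Quot ass R (S i)) (loc_ring R (S i)) \<sigma> \<and>
      (\<forall>r\<in>carrier R. \<sigma> (ass R (S i) +>\<^bsub>R\<^esub> r) = loc_map R (S i) r)" if "i < n" for i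
    by (intro exI[of _ "\<lambda>U. the_elem (h i ` U)"] conjI p3[OF that] ballI coset[OF that])
  show ?thesis
    by (intro conjI allI impI p1 p2 p3' p4 exI[of _ "fraction_family.prod_map n h"] p5 p6)
qed

end
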